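(* Initial lexsegment edge ideals have homological linear powers. That is, for every squarefree monomial $v=x_px_q\in S=K[x_1,\dots,x_n]$ of degree two, the ideal $I=\mathcal{L}^{\mathrm{i}}(v)$ is such that $\mathrm{HS}_i(I^k)$ has a linear resolution for all integers $i\ge0$ and $k\ge1$.
   Context: $K$ is a field and $S=K[x_1,\dots,x_n]$ is the standard graded polynomial ring. Let $>_{\mathrm{lex}}$ be the lexicographic order on $S$ induced by $x_1>\cdots>x_n$. For a squarefree monomial $v\in S$ of degree $d$, the squarefree initial lexsegment ideal defined by $v$ is $$\mathcal{L}^{\mathrm{i}}(v)=(w\in S : w\text{ is a squarefree monomial with }\deg(w)=d,\ w\ge_{\mathrm{lex}}v).$$ If $v=x_px_q$ is a squarefree monomial of degree two, $\mathcal{L}^{\mathrm{i}}(v)$ is called an initial lexsegment edge ideal. For ${\bf a}=(a_1,\dots,a_n)\in\mathbb{Z}_{\ge0}^n$ put ${\bf x}^{\bf a}=x_1^{a_1}\cdots x_n^{a_n}$. The $i$th homological shift ideal of a monomial ideal $I\subset S$ is $\mathrm{HS}_i(I)=({\bf x}^{\bf a} : \mathrm{Tor}_i^S(K,I)_{\bf a}\ne0)$. A monomial ideal $I$ has homological linear powers if $\mathrm{HS}_i(I^k)$ has a linear resolution for all $i\ge0$ and all $k\ge1$. The zero ideal is regarded as having a linear resolution. *)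

theory Defs
  imports Complex_Main "HOL-Library.Poly_Mapping"
begin

text \<open>
  The polynomial ring \<open>S = K[x\<^sub>1, \<dots>, x\<^sub>n]\<close> is the monoid algebra \<open>('n, 'k) mpoly\<close>. The
  variables are indexed by an arbitrary finite linear order \<open>'n\<close> with \<open>n\<close> elements;
  \<open>x\<^sub>1, \<dots>, x\<^sub>n\<close> are the variables listed by increasing index.
\<close>

type_synonym 'n exponent = "'n \<Rightarrow>\<^sub>0 nat"
type_synonym ('n, 'k) mpoly = "('n \<Rightarrow>\<^sub>0 nat) \<Rightarrow>\<^sub>0 'k"

definition monomial :: "'n exponent \<Rightarrow> ('n, 'k::field) mpoly" where
  "monomial a = Poly_Mapping.single a 1"

definition total_degree :: "'n::finite exponent \<Rightarrow> nat" where
  "total_degree a = (\<Sum>i\<in>UNIV. Poly_Mapping.lookup a i)"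

definition squarefree_exponent :: "'n exponent \<Rightarrow> bool" where
  "squarefree_exponent a \<longleftrightarrow> (\<forall>i. Poly_Mapping.lookup a i \<le> 1)"

text \<open>
  \<open>lex_ge a b\<close> is \<open>x\<^sup>a \<ge>\<^sub>l\<^sub>e\<^sub>x x\<^sup>b\<close> for the lexicographic order induced by
  \<open>x\<^sub>1 > \<dots> > x\<^sub>n\<close>: a smaller index is a larger variable.
\<close>

definition lex_ge :: "'n::linorder exponent \<Rightarrow> 'n exponent \<Rightarrow> bool" where
  "lex_ge a b \<longleftrightarrow> a = b \<or>
     (\<exists>i. Poly_Mapping.lookup a i > Poly_Mapping.lookup b i \<and>
          (\<forall>j<i. Poly_Mapping.lookup a j = Poly_Mapping.lookup b j))"

definition ideal_generated :: "'a::comm_ring_1 set \<Rightarrow> 'a set" where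
  "ideal_generated B = module.span (*) B"

fun ideal_power :: "'a::comm_ring_1 set \<Rightarrow> nat \<Rightarrow> 'a set" where
  "ideal_power I 0 = UNIV"
| "ideal_power I (Suc k) = ideal_generated {f * g | f g. f \<in> I \<and> g \<in> ideal_power I k}"

definition initial_lexsegment_ideal ::
    "'n::{finite,linorder} exponent \<Rightarrow> ('n, 'k::field) mpoly set" where
  "initial_lexsegment_ideal v = ideal_generated
     {monomial w | w. squarefree_exponent w \<and> total_degree w = total_degree v \<and> lex_ge w v}"

text \<open>
  Complexes \<open>\<cdots> \<rightarrow> F\<^sub>1 \<rightarrow> F\<^sub>0 \<rightarrow> S\<close> of finitely generated graded free modules, given by
  matrices. The module \<open>F\<^sub>i\<close> has basis \<open>e\<^sub>i\<^sub>,\<^sub>0, \<dots>, e\<^sub>i\<^sub>,\<^sub>r\<^sub>-\<^sub>1\<close> with \<open>r = rank F i\<close>, and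
  \<open>e\<^sub>i\<^sub>,\<^sub>j\<close> has degree \<open>shift F i j\<close>, so \<open>F\<^sub>i\<close> is the direct sum of the modules
  \<open>S(- shift F i j)\<close>. The augmentation \<open>F\<^sub>0 \<rightarrow> S\<close> sends \<open>e\<^sub>0\<^sub>,\<^sub>j\<close> to \<open>aug F j\<close>, and the
  differential sends \<open>e\<^sub>i\<^sub>+\<^sub>1\<^sub>,\<^sub>j\<close> to the sum of the \<open>bd F i j l \<cdot> e\<^sub>i\<^sub>,\<^sub>l\<close>.
\<close>

record ('g, 's) free_complex =
  rank :: "nat \<Rightarrow> nat"
  shift :: "nat \<Rightarrow> nat \<Rightarrow> 'g"
  aug :: "nat \<Rightarrow> 's"
  bd :: "nat \<Rightarrow> nat \<Rightarrow> nat \<Rightarrow> 's"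

definition free_mod :: "nat \<Rightarrow> (nat \<Rightarrow> 's::zero) set" where
  "free_mod r = {f. \<forall>j\<ge>r. f j = 0}"

definition apply_matrix ::
    "nat \<Rightarrow> nat \<Rightarrow> (nat \<Rightarrow> nat \<Rightarrow> 's) \<Rightarrow> (nat \<Rightarrow> 's) \<Rightarrow> nat \<Rightarrow> 's::comm_ring_1" where
  "apply_matrix r s M f = (\<lambda>l. if l < s then \<Sum>j<r. f j * M j l else 0)"

definition differential ::
    "('g, 's::comm_ring_1) free_complex \<Rightarrow> nat \<Rightarrow> (nat \<Rightarrow> 's) \<Rightarrow> nat \<Rightarrow> 's" where
  "differential F i = apply_matrix (rank F (Suc i)) (rank F i) (bd F i)"

definition augmentation ::
    "('g, 's::comm_ring_1) free_complex \<Rightarrow> (nat \<Rightarrow> 's) \<Rightarrow> 's" where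
  "augmentation F f = (\<Sum>j<rank F 0. f j * aug F j)"

text \<open>
  A graded free resolution of \<open>I\<close> for the grading in which \<open>x\<^sup>a\<close> has degree \<open>wt a\<close>;
  \<open>wt = (\<lambda>a. a)\<close> is the multigrading and \<open>wt = total_degree\<close> the standard grading.
  The first two conditions say that the augmentation and the differentials preserve degrees.
\<close>

definition graded_free_resolution ::
    "('n exponent \<Rightarrow> 'g::monoid_add) \<Rightarrow> ('g, ('n, 'k::field) mpoly) free_complex
      \<Rightarrow> ('n, 'k) mpoly set \<Rightarrow> bool" where
  "graded_free_resolution wt F I \<longleftrightarrow>
     (\<forall>j<rank F 0. \<forall>a\<in>Poly_Mapping.keys (aug F j). wt a = shift F 0 j) \<and>
     (\<forall>i. \<forall>j<rank F (Suc i). \<forall>l<rank F i. \<forall>a\<in>Poly_Mapping.keys (bd F i j l).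
        wt a + shift F i l = shift F (Suc i) j) \<and>
     augmentation F ` free_mod (rank F 0) = I \<and>
     {f \<in> free_mod (rank F 0). augmentation F f = 0} =
       differential F 0 ` free_mod (rank F 1) \<and>
     (\<forall>i. {f \<in> free_mod (rank F (Suc i)). differential F i f = (\<lambda>_. 0)} =
        differential F (Suc i) ` free_mod (rank F (Suc (Suc i))))"

text \<open>
  A \<open>d\<close>-linear resolution is a graded free resolution with every \<open>F\<^sub>i\<close> of the form
  \<open>S(-d-i)\<^bsup>r\<^esup>\<close>. For the zero ideal the zero complex is one.
\<close>

definition has_linear_resolution :: "('n::finite, 'k::field) mpoly set \<Rightarrow> bool" where
  "has_linear_resolution I \<longleftrightarrow>
     (\<exists>d F. graded_free_resolution total_degree F I \<and>
            (\<forall>i. \<forall>j<rank F i. shift F i j = d + i))"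

text \<open>
  \<open>Tor\<^sub>i(K, I)\<^sub>a\<close> is the component of multidegree \<open>a\<close> of \<open>H\<^sub>i(K \<otimes> F)\<close>, where \<open>F\<close> is a
  multigraded free resolution of \<open>I\<close> and \<open>K = S/(x\<^sub>1, \<dots>, x\<^sub>n)\<close> sits in degree \<open>0\<close>. So
  \<open>(K \<otimes> F\<^sub>i)\<^sub>a\<close> has as basis the \<open>e\<^sub>i\<^sub>,\<^sub>j\<close> of degree \<open>a\<close>, and the matrix of a tensored
  differential consists of the constant terms of the original entries.
\<close>

definition tensor_part ::
    "('n exponent, ('n, 'k::field) mpoly) free_complex \<Rightarrow> nat \<Rightarrow> 'n exponent
      \<Rightarrow> (nat \<Rightarrow> 'k) set" where
  "tensor_part F i a = {f \<in> free_mod (rank F i). \<forall>j. f j \<noteq> 0 \<longrightarrow> shift F i j = a}"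

definition tensor_differential ::
    "('n exponent, ('n, 'k::field) mpoly) free_complex \<Rightarrow> nat
      \<Rightarrow> (nat \<Rightarrow> 'k) \<Rightarrow> nat \<Rightarrow> 'k" where
  "tensor_differential F i =
     apply_matrix (rank F (Suc i)) (rank F i) (\<lambda>j l. Poly_Mapping.lookup (bd F i j l) 0)"

definition tensor_cycles ::
    "('n exponent, ('n, 'k::field) mpoly) free_complex \<Rightarrow> nat \<Rightarrow> 'n exponent
      \<Rightarrow> (nat \<Rightarrow> 'k) set" where
  "tensor_cycles F i a = (case i of 0 \<Rightarrow> tensor_part F 0 a
     | Suc h \<Rightarrow> {f \<in> tensor_part F i a. tensor_differential F h f = (\<lambda>_. 0)})"

definition tensor_boundaries ::
    "('n exponent, ('n, 'k::field) mpoly) free_complex \<Rightarrow> nat \<Rightarrow> 'n exponent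
      \<Rightarrow> (nat \<Rightarrow> 'k) set" where
  "tensor_boundaries F i a = tensor_differential F i ` tensor_part F (Suc i) a"

text \<open>
  \<open>Tor\<close> does not depend on the choice of the resolution, so it is nonzero if and only if
  its computation from some resolution has a cycle that is not a boundary.
\<close>

definition Tor_nonzero ::
    "nat \<Rightarrow> ('n, 'k::field) mpoly set \<Rightarrow> 'n exponent \<Rightarrow> bool" where
  "Tor_nonzero i I a \<longleftrightarrow>
     (\<exists>F. graded_free_resolution (\<lambda>b. b) F I \<and>
          \<not> tensor_cycles F i a \<subseteq> tensor_boundaries F i a)"

definition homological_shift_ideal ::
    "nat \<Rightarrow> ('n, 'k::field) mpoly set \<Rightarrow> ('n, 'k) mpoly set" where
  "homological_shift_ideal i I = ideal_generated {monomial a | a. Tor_nonzero i I a}"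

definition has_homological_linear_powers :: "('n::finite, 'k::field) mpoly set \<Rightarrow> bool" where
  "has_homological_linear_powers I \<longleftrightarrow>
     (\<forall>i. \<forall>k\<ge>1. has_linear_resolution (homological_shift_ideal i (ideal_power I k)))"

end

theory Submission
  imports Defs
begin

text \<open>
  Let \<open>p < q\<close> and let \<open>I\<close> be the initial lexsegment edge ideal of \<open>x\<^sub>p x\<^sub>q\<close>. In the graph of
  \<open>I\<close> a vertex \<open>i < p\<close> is joined to every other vertex, and \<open>p\<close> is joined to
  \<open>p + 1, \<dots>, q\<close> as well; so the maximal independent sets are the singletons \<open>{i}\<close> with
  \<open>i < p\<close>, the set \<open>T = {p<..}\<close> and the set \<open>B = {p} \<union> {q<..}\<close>.

  A product of \<open>k\<close> edges has weight at most \<open>k\<close> on every independent set. These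
  inequalities suffice: the generators of \<open>I\<^sup>k\<close> are exactly the exponents \<open>u\<close> of degree
  \<open>2 k\<close> that have all entries, the weight on \<open>T\<close> and the weight on \<open>B\<close> at most \<open>k\<close>
  (\<open>power_exponents\<close>, \<open>ideal_power_lexsegment\<close>), because from any such \<open>u\<close> one can
  split off an edge that meets all inequalities which are sharp (\<open>obtain_edge\<close>).

  The notion that carries the proof is the exchange property \<open>lex_exchange\<close>: if \<open>v\<close> and
  \<open>w\<close> are generators and \<open>i\<close> is the first place where they differ, with
  \<open>w\<^sub>i < v\<^sub>i\<close>, then some \<open>x\<^sub>i w / x\<^sub>j\<close> with \<open>j > i\<close> is again a generator. It says that
  the generators, added in decreasing lexicographic order, have linear quotients: the colon
  ideal at \<open>w\<close> is generated by the variables in \<open>exchange_variables\<close>. Iterated mapping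
  cones (\<open>resolution_add_generator\<close>) then give a multigraded resolution whose basis elements
  in homological degree \<open>r\<close> have the degrees \<open>w x\<^sub>\<tau>\<close>, where \<open>\<tau>\<close> runs over the
  \<open>r\<close>-element sets of exchange variables of \<open>w\<close>. When all generators have the same degree
  this resolution is linear, hence minimal, and \<open>Tor\<close> can be read off from it
  (\<open>lex_exchange_linear_resolution\<close>, \<open>lex_exchange_Tor\<close>).

  The generators of \<open>I\<^sup>k\<close> have the exchange property, and the exchange variables of \<open>u\<close>
  are the \<open>i\<close> with \<open>u\<^sub>i < k\<close> that are smaller than some index in the support of \<open>u\<close>.
  Therefore \<open>HS\<^sub>r(I\<^sup>k)\<close> is generated by the \<open>u x\<^sub>\<sigma>\<close> with \<open>\<sigma>\<close> an \<open>r\<close>-element set of such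
  indices. The heart of the matter is \<open>lex_exchange_shift_exponents\<close>: these monomials have
  the exchange property once more, so they generate an ideal with a linear resolution.
\<close>

section \<open>Monomial ideals\<close>

abbreviation "lookup \<equiv> Poly_Mapping.lookup"
abbreviation "keys \<equiv> Poly_Mapping.keys"

text \<open>
  Membership is decided on the support, so no coefficients are involved. By
  \<open>ideal_generated_monomials\<close> this is the ideal generated by the monomials with exponents in
  \<open>A\<close>.
\<close>

definition monomial_ideal :: "'n exponent set \<Rightarrow> ('n, 'k::field) mpoly set" where
  "monomial_ideal A = {f. \<forall>c\<in>keys f. \<exists>a\<in>A. \<exists>b. c = a + b}"

text \<open>
  Usually \<open>P\<close> singles out one multidegree, for an entry of a vector the one that makes the
  vector homogeneous.
\<close>

definition homogeneous_part :: "('a \<Rightarrow> bool) \<Rightarrow> ('a \<Rightarrow>\<^sub>0 'b::zero) \<Rightarrow> 'a \<Rightarrow>\<^sub>0 'b" where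
  "homogeneous_part P f = Abs_poly_mapping (\<lambda>a. lookup f a when P a)"

lemma lookup_homogeneous_part: "lookup (homogeneous_part P f) a = (lookup f a when P a)"
proof -
  have "finite {a. (lookup f a when P a) \<noteq> 0}"
    by (rule finite_subset[OF _ finite_keys[of f]]) (auto simp: in_keys_iff)
  then show ?thesis
    unfolding homogeneous_part_def by simp
qed

lemma keys_homogeneous_part: "keys (homogeneous_part P f) = {a \<in> keys f. P a}"
  by (auto simp: in_keys_iff lookup_homogeneous_part)

lemma homogeneous_part_split:
  fixes f :: "'a \<Rightarrow>\<^sub>0 'b::comm_monoid_add"
  shows "f = homogeneous_part P f + homogeneous_part (\<lambda>a. \<not> P a) f"
  by (rule poly_mapping_eqI) (auto simp: lookup_add lookup_homogeneous_part when_def)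

lemma homogeneous_part_add:
  fixes f g :: "'a \<Rightarrow>\<^sub>0 'b::comm_monoid_add"
  shows "homogeneous_part P (f + g) = homogeneous_part P f + homogeneous_part P g"
  by (rule poly_mapping_eqI) (auto simp: lookup_add lookup_homogeneous_part when_def)

lemma homogeneous_part_zero [simp]: "homogeneous_part P 0 = 0"
  by (rule poly_mapping_eqI) (auto simp: lookup_homogeneous_part when_def)

lemma homogeneous_part_sum:
  fixes f :: "'i \<Rightarrow> 'a \<Rightarrow>\<^sub>0 'b::comm_monoid_add"
  shows "homogeneous_part P (sum f X) = (\<Sum>i\<in>X. homogeneous_part P (f i))"
  by (induction X rule: infinite_finite_induct) (auto simp: homogeneous_part_add)

lemma homogeneous_part_id: "(\<And>a. a \<in> keys f \<Longrightarrow> P a) \<Longrightarrow> homogeneous_part P f = f"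
  by (rule poly_mapping_eqI) (auto simp: lookup_homogeneous_part when_def in_keys_iff)

lemma homogeneous_part_none: "(\<And>a. a \<in> keys f \<Longrightarrow> \<not> P a) \<Longrightarrow> homogeneous_part P f = 0"
  by (rule poly_mapping_eqI) (auto simp: lookup_homogeneous_part when_def in_keys_iff)

text \<open>
  Multiplication by a homogeneous factor shifts degrees; \<open>P'\<close> is \<open>P\<close> after that shift.
\<close>

lemma homogeneous_part_mult:
  fixes f m :: "'a::comm_monoid_add \<Rightarrow>\<^sub>0 'b::comm_ring_1"
  assumes "\<And>a c. c \<in> keys m \<Longrightarrow> P' (a + c) = P a"
  shows "homogeneous_part P' (f * m) = homogeneous_part P f * m"
proof -
  have "homogeneous_part P' (homogeneous_part P f * m) = homogeneous_part P f * m"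
    using keys_mult[of "homogeneous_part P f" m] assms
    by (intro homogeneous_part_id) (auto simp: keys_homogeneous_part)
  moreover have "homogeneous_part P' (homogeneous_part (\<lambda>a. \<not> P a) f * m) = 0"
    using keys_mult[of "homogeneous_part (\<lambda>a. \<not> P a) f" m] assms
    by (intro homogeneous_part_none) (auto simp: keys_homogeneous_part)
  ultimately show ?thesis
    by (subst homogeneous_part_split[of f P]) (simp add: distrib_right homogeneous_part_add)
qed

lemma module_mult: "module ((*) :: 'a::comm_ring_1 \<Rightarrow> 'a \<Rightarrow> 'a)"
  by unfold_locales (auto simp: algebra_simps)

lemma poly_mapping_sum_single: "f = (\<Sum>c\<in>keys f. Poly_Mapping.single c (lookup f c))"
  by (rule poly_mapping_eqI)
    (auto simp: lookup_sum lookup_single when_def in_keys_iff sum.delta)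

lemma lookup_mult_single:
  fixes f :: "('n exponent) \<Rightarrow>\<^sub>0 'k::field"
  shows "lookup (f * Poly_Mapping.single u 1) (c + u) = lookup f c"
proof -
  have "lookup (homogeneous_part (\<lambda>a. a = c + u) (f * Poly_Mapping.single u 1)) (c + u)
      = lookup (homogeneous_part (\<lambda>a. a = c) f * Poly_Mapping.single u 1) (c + u)"
    by (subst homogeneous_part_mult[where P = "\<lambda>a. a = c"]) auto
  moreover have "homogeneous_part (\<lambda>a. a = c) f = Poly_Mapping.single c (lookup f c)"
    by (rule poly_mapping_eqI) (auto simp: lookup_homogeneous_part lookup_single when_def)
  ultimately show ?thesis
    by (simp add: lookup_homogeneous_part mult_single)
qed

lemma keys_mult_monomial:
  fixes f :: "('n, 'k::field) mpoly"
  shows "keys (f * monomial u) = (\<lambda>c. c + u) ` keys f"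
proof
  show "keys (f * monomial u) \<subseteq> (\<lambda>c. c + u) ` keys f"
    using keys_mult[of f "monomial u"] by (auto simp: monomial_def)
  show "(\<lambda>c. c + u) ` keys f \<subseteq> keys (f * monomial u)"
    by (auto simp: in_keys_iff monomial_def lookup_mult_single)
qed

lemma monomial_in_monomial_ideal [simp]:
  "(monomial c :: ('n, 'k::field) mpoly) \<in> monomial_ideal A \<longleftrightarrow> (\<exists>a\<in>A. \<exists>b. c = a + b)"
  by (auto simp: monomial_ideal_def monomial_def)

lemma monomial_generator_in: "a \<in> A \<Longrightarrow> monomial a \<in> monomial_ideal A"
  by (auto intro!: bexI[of _ a] exI[of _ 0])

lemma subspace_monomial_ideal:
  "module.subspace (*) (monomial_ideal A :: ('n, 'k::field) mpoly set)"
proof (rule module.subspaceI[OF module_mult])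
  fix f g :: "('n, 'k) mpoly"
  assume fg: "f \<in> monomial_ideal A" "g \<in> monomial_ideal A"
  then show "f + g \<in> monomial_ideal A"
    using keys_add[of f g] unfolding monomial_ideal_def by blast
next
  fix f h :: "('n, 'k) mpoly"
  assume "f \<in> monomial_ideal A"
  then show "h * f \<in> monomial_ideal A"
    unfolding monomial_ideal_def
  proof clarify
    fix c assume f: "\<forall>c\<in>keys f. \<exists>a\<in>A. \<exists>b. c = a + b" and "c \<in> keys (h * f)"
    then obtain x y where xy: "c = x + y" "y \<in> keys f" using keys_mult[of h f] by blast
    with f obtain a b where "a \<in> A" "y = a + b" by blast
    with xy have "c = a + (x + b)" by (simp add: ac_simps)
    with \<open>a \<in> A\<close> show "\<exists>a\<in>A. \<exists>b. c = a + b" by blast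
  qed
qed (simp add: monomial_ideal_def)

lemma single_in_ideal_generated:
  assumes "a \<in> A"
  shows "Poly_Mapping.single (a + b) c \<in> ideal_generated (monomial ` A)"
proof -
  have "Poly_Mapping.single (a + b) c = Poly_Mapping.single b c * monomial a"
    by (simp add: monomial_def mult_single add.commute)
  also have "\<dots> \<in> ideal_generated (monomial ` A)"
    unfolding ideal_generated_def using assms
    by (intro module.span_scale[OF module_mult] module.span_base[OF module_mult]) auto
  finally show ?thesis .
qed

lemma ideal_generated_monomials:
  "ideal_generated (monomial ` A) = (monomial_ideal A :: ('n, 'k::field) mpoly set)"
proof
  show "ideal_generated (monomial ` A) \<subseteq> (monomial_ideal A :: ('n, 'k) mpoly set)"
    unfolding ideal_generated_def
    by (rule module.span_minimal[OF module_mult _ subspace_monomial_ideal])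
      (auto simp del: monomial_in_monomial_ideal intro: monomial_generator_in)
  show "monomial_ideal A \<subseteq> (ideal_generated (monomial ` A) :: ('n, 'k) mpoly set)"
  proof
    fix f :: "('n, 'k) mpoly" assume f: "f \<in> monomial_ideal A"
    have "(\<Sum>c\<in>keys f. Poly_Mapping.single c (lookup f c)) \<in> ideal_generated (monomial ` A)"
      unfolding ideal_generated_def
    proof (rule module.span_sum[OF module_mult], fold ideal_generated_def)
      fix c assume "c \<in> keys f"
      then obtain a b where "a \<in> A" "c = a + b"
        using f by (auto simp: monomial_ideal_def)
      then show "Poly_Mapping.single c (lookup f c) \<in> ideal_generated (monomial ` A)"
        by (simp add: single_in_ideal_generated)
    qed
    then show "f \<in> ideal_generated (monomial ` A)"
      by (simp flip: poly_mapping_sum_single)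
  qed
qed

lemma ideal_product_monomial_ideals:
  "ideal_generated {f * g | f g. f \<in> monomial_ideal A \<and> g \<in> monomial_ideal B}
    = (monomial_ideal {a + b | a b. a \<in> A \<and> b \<in> B} :: ('n, 'k::field) mpoly set)"
    (is "?L = monomial_ideal ?C")
proof
  show "?L \<subseteq> monomial_ideal ?C"
    unfolding ideal_generated_def
  proof (rule module.span_minimal[OF module_mult _ subspace_monomial_ideal], clarify)
    fix f g :: "('n, 'k) mpoly"
    assume fg: "f \<in> monomial_ideal A" "g \<in> monomial_ideal B"
    show "f * g \<in> monomial_ideal ?C"
      unfolding monomial_ideal_def
    proof clarify
      fix c assume "c \<in> keys (f * g)"
      then obtain x y where xy: "c = x + y" "x \<in> keys f" "y \<in> keys g"
        using keys_mult[of f g] by auto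
      obtain a a' b b' where "x = a + a'" "y = b + b'" "a \<in> A" "b \<in> B"
        using xy fg unfolding monomial_ideal_def by blast
      then have "c = (a + b) + (a' + b')" "a + b \<in> ?C"
        using xy by (auto simp: ac_simps)
      then show "\<exists>a\<in>?C. \<exists>b. c = a + b" by blast
    qed
  qed
  show "monomial_ideal ?C \<subseteq> ?L"
    unfolding ideal_generated_monomials[symmetric] ideal_generated_def
  proof (rule module.span_mono[OF module_mult], clarify)
    fix a b assume "a \<in> A" "b \<in> B"
    then show "\<exists>f g. monomial (a + b) = f * g \<and> f \<in> module.span (*) (monomial ` A)
        \<and> g \<in> module.span (*) (monomial ` B)"
      by (intro exI[of _ "monomial a"] exI[of _ "monomial b"])
        (auto simp: monomial_def mult_single intro!: module.span_base[OF module_mult])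
  qed
qed

definition colon_monomial :: "('n, 'k::field) mpoly set \<Rightarrow> 'n exponent \<Rightarrow> ('n, 'k) mpoly set" where
  "colon_monomial J u = {f. f * monomial u \<in> J}"

text \<open>
  The support of an element is split into the exponents that are multiples of elements of
  \<open>A\<close> and the remaining ones, which are then multiples of \<open>u\<close>.
\<close>

lemma monomial_ideal_insert:
  "(monomial_ideal (insert u A) :: ('n, 'k::field) mpoly set)
    = {f + s * monomial u | f s. f \<in> monomial_ideal A}"
proof (intro equalityI subsetI)
  fix x :: "('n, 'k) mpoly" assume x: "x \<in> monomial_ideal (insert u A)"
  define P where "P c \<longleftrightarrow> (\<exists>a\<in>A. \<exists>b. c = a + b)" for c
  have "homogeneous_part (\<lambda>c. \<not> P c) x \<in> monomial_ideal {u}"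
    using x by (auto simp: monomial_ideal_def keys_homogeneous_part P_def)
  also have "monomial_ideal {u} = range (\<lambda>s. s * (monomial u :: ('n, 'k) mpoly))"
    by (simp add: module.span_singleton[OF module_mult] flip: ideal_generated_monomials
        add: ideal_generated_def)
  finally obtain s where "homogeneous_part (\<lambda>c. \<not> P c) x = s * monomial u" by auto
  then have "x = homogeneous_part P x + s * monomial u"
    using homogeneous_part_split[of x P] by simp
  moreover have "homogeneous_part P x \<in> monomial_ideal A"
    by (auto simp: monomial_ideal_def keys_homogeneous_part P_def)
  ultimately show "x \<in> {f + s * monomial u | f s. f \<in> monomial_ideal A}" by blast
next
  fix x :: "('n, 'k) mpoly" assume "x \<in> {f + s * monomial u | f s. f \<in> monomial_ideal A}"
  then obtain f s where x: "x = f + s * monomial u" "f \<in> monomial_ideal A" by blast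
  have "f \<in> monomial_ideal (insert u A)" using x by (auto simp: monomial_ideal_def)
  moreover have "s * monomial u \<in> monomial_ideal (insert u A)"
    by (rule module.subspace_scale[OF module_mult subspace_monomial_ideal])
      (auto simp del: monomial_in_monomial_ideal intro: monomial_generator_in)
  ultimately show "x \<in> monomial_ideal (insert u A)"
    unfolding x(1) by (rule module.subspace_add[OF module_mult subspace_monomial_ideal])
qed

lemma exponent_le_iff:
  fixes a c :: "'n exponent"
  shows "(\<exists>b. c = a + b) \<longleftrightarrow> (\<forall>t. lookup a t \<le> lookup c t)"
proof
  assume "\<forall>t. lookup a t \<le> lookup c t"
  then have "c = a + (c - a)"
    by (intro poly_mapping_eqI) (simp add: lookup_add lookup_minus)
  then show "\<exists>b. c = a + b" ..
qed (auto simp: lookup_add)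

abbreviation unit_exponent :: "'n \<Rightarrow> 'n exponent" where
  "unit_exponent t \<equiv> Poly_Mapping.single t (Suc 0)"

text \<open>
  The criterion for linear quotients. The first assumption puts the variables into the colon
  ideal. The second shows that there is nothing else: if \<open>a\<close> divides \<open>c + u\<close> and
  \<open>u\<^sub>t < a\<^sub>t\<close>, then \<open>c\<^sub>t > 0\<close>.
\<close>

lemma colon_monomial_ideal_variables:
  assumes "\<And>t. t \<in> S \<Longrightarrow> \<exists>a\<in>A. \<exists>b. u + unit_exponent t = a + b"
    and "\<And>a. a \<in> A \<Longrightarrow> \<exists>t\<in>S. lookup u t < lookup a t"
  shows "colon_monomial (monomial_ideal A) u
    = (monomial_ideal (unit_exponent ` S) :: ('n, 'k::field) mpoly set)"
proof -
  have "(\<exists>a\<in>A. \<exists>b. c + u = a + b) \<longleftrightarrow> (\<exists>t\<in>S. \<exists>b. c = unit_exponent t + b)" for c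
  proof
    assume "\<exists>a\<in>A. \<exists>b. c + u = a + b"
    then obtain a where "a \<in> A" and a: "\<exists>b. c + u = a + b" by blast
    then obtain t where t: "t \<in> S" "lookup u t < lookup a t" using assms(2) by blast
    with a have "lookup c t > 0" unfolding exponent_le_iff lookup_add by (metis add_0 bot_nat_0.not_eq_extremum not_le)
    then have "\<exists>b. c = unit_exponent t + b"
      unfolding exponent_le_iff by (auto simp: lookup_single when_def)
    with t show "\<exists>t\<in>S. \<exists>b. c = unit_exponent t + b" by blast
  next
    assume "\<exists>t\<in>S. \<exists>b. c = unit_exponent t + b"
    then obtain t b where t: "t \<in> S" "c = unit_exponent t + b" by blast
    obtain a b' where a: "a \<in> A" "u + unit_exponent t = a + b'" using assms(1)[OF t(1)] by blast
    have "c + u = (u + unit_exponent t) + b" using t by (simp add: ac_simps)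
    also have "\<dots> = a + (b' + b)" using a by (simp add: ac_simps)
    finally show "\<exists>a\<in>A. \<exists>b. c + u = a + b" using a by blast
  qed
  then show ?thesis
    by (auto simp: colon_monomial_def monomial_ideal_def keys_mult_monomial)
qed

section \<open>Matrices acting on free modules\<close>

text \<open>
  The rows of \<open>M\<close> are the images of the basis vectors. Unlike \<open>apply_matrix\<close>, this does not
  mention the rank of the target, which is instead encoded by the rows lying in a free module;
  so composition of maps needs no side conditions (\<open>lin_lin\<close>).
\<close>

definition lin :: "nat \<Rightarrow> (nat \<Rightarrow> nat \<Rightarrow> 's::comm_ring_1) \<Rightarrow> (nat \<Rightarrow> 's) \<Rightarrow> nat \<Rightarrow> 's" where
  "lin r M f = (\<lambda>l. \<Sum>j<r. f j * M j l)"

definition unit_vector :: "nat \<Rightarrow> nat \<Rightarrow> 's::comm_ring_1" where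
  "unit_vector j = (\<lambda>l. if l = j then 1 else 0)"

text \<open>
  The identification of the ring with the free module of rank one.
\<close>

definition first_entry :: "'s::zero \<Rightarrow> nat \<Rightarrow> 's" where
  "first_entry x = (\<lambda>l. if l = 0 then x else 0)"

text \<open>
  Elements, rows and degrees of a direct sum with a first summand of rank \<open>r\<close>.
\<close>

definition join :: "nat \<Rightarrow> (nat \<Rightarrow> 'b) \<Rightarrow> (nat \<Rightarrow> 'b) \<Rightarrow> nat \<Rightarrow> 'b" where
  "join r f g = (\<lambda>l. if l < r then f l else g (l - r))"

lemma lin_lin: "lin s D (lin r M f) = lin r (\<lambda>j. lin s D (M j)) f"
proof
  fix l
  have "lin s D (lin r M f) l = (\<Sum>t<s. \<Sum>j<r. f j * M j t * D t l)"
    by (simp add: lin_def sum_distrib_right)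
  also have "\<dots> = (\<Sum>j<r. \<Sum>t<s. f j * M j t * D t l)"
    by (rule sum.swap)
  also have "\<dots> = lin r (\<lambda>j. lin s D (M j)) f l"
    by (simp add: lin_def sum_distrib_left mult.assoc)
  finally show "lin s D (lin r M f) l = lin r (\<lambda>j. lin s D (M j)) f l" .
qed

lemma lin_cong: "(\<And>j. j < r \<Longrightarrow> M j = N j) \<Longrightarrow> (\<And>j. j < r \<Longrightarrow> f j = g j) \<Longrightarrow> lin r M f = lin r N g"
  by (auto simp: lin_def intro!: ext sum.cong)

lemma lin_unit_vector: "j < r \<Longrightarrow> lin r M (unit_vector j) = M j"
  by (auto simp: lin_def unit_vector_def if_distrib[of "\<lambda>x. x * _"] sum.delta cong: if_cong)

lemma lin_to_unit_vectors: "f \<in> free_mod r \<Longrightarrow> lin r unit_vector f = f"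
proof
  fix l assume "f \<in> free_mod r"
  then show "lin r unit_vector f l = f l"
    by (cases "l < r")
      (auto simp: lin_def unit_vector_def if_distrib[of "\<lambda>x. _ * x"] sum.delta free_mod_def
        cong: if_cong)
qed

lemma lin_add: "lin r M (\<lambda>l. f l + g l) = (\<lambda>l. lin r M f l + lin r M g l)"
  and lin_diff: "lin r M (\<lambda>l. f l - g l) = (\<lambda>l. lin r M f l - lin r M g l)"
  and lin_uminus: "lin r M (\<lambda>l. - f l) = (\<lambda>l. - lin r M f l)"
  and lin_scale: "lin r M (\<lambda>l. c * f l) = (\<lambda>l. c * lin r M f l)"
  and lin_zero [simp]: "lin r M (\<lambda>_. 0) = (\<lambda>_. 0)"
  and lin_matrix_diff: "lin r (\<lambda>j l. M j l - N j l) f = (\<lambda>l. lin r M f l - lin r N f l)"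
  and lin_matrix_uminus: "lin r (\<lambda>j l. - M j l) f = (\<lambda>l. - lin r M f l)"
  by (auto simp: lin_def distrib_right left_diff_distrib right_diff_distrib sum.distrib
      sum_subtractf sum_negf sum_distrib_left mult.assoc)

lemma lin_in_free_mod: "(\<And>j. j < r \<Longrightarrow> M j \<in> free_mod s) \<Longrightarrow> lin r M f \<in> free_mod s"
  by (auto simp: lin_def free_mod_def intro!: sum.neutral)

lemma range_lin: "range (lin r M) = lin r M ` free_mod r"
proof (intro equalityI subsetI)
  fix y assume "y \<in> range (lin r M)"
  then obtain f where "y = lin r M f" by blast
  also have "\<dots> = lin r M (\<lambda>j. if j < r then f j else 0)" by (rule lin_cong) auto
  finally show "y \<in> lin r M ` free_mod r" by (auto simp: free_mod_def)
qed auto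

lemma sum_lessThan_add:
  fixes f :: "nat \<Rightarrow> 'b::comm_monoid_add"
  shows "(\<Sum>j<r + s. f j) = (\<Sum>j<r. f j) + (\<Sum>j<s. f (r + j))"
  by (induction s) (auto simp: ac_simps)

lemma lin_join: "lin (r + s) (join r M N) (join r f g) = (\<lambda>l. lin r M f l + lin s N g l)"
  by (simp add: lin_def sum_lessThan_add join_def)

lemma lin_columns_join: "lin s (\<lambda>j. join r (A j) (B j)) g = join r (lin s A g) (lin s B g)"
  by (auto simp: lin_def join_def)

lemma add_join: "f \<in> free_mod r \<Longrightarrow> (\<lambda>l. f l + join r g h l) = join r (\<lambda>l. f l + (g l :: 's::comm_ring_1)) h"
  by (auto simp: join_def free_mod_def fun_eq_iff)

lemma join_split: "join r h (\<lambda>l. h (r + l)) = h"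
  by (auto simp: join_def)

lemma join_in_free_mod [simp]: "g \<in> free_mod s \<Longrightarrow> join r f g \<in> free_mod (r + s)"
  by (auto simp: join_def free_mod_def)

lemma join_eq_zero: "f \<in> free_mod r \<Longrightarrow> join r f g = (\<lambda>_. 0) \<longleftrightarrow> f = (\<lambda>_. 0) \<and> g = (\<lambda>_. 0)"
proof
  assume f: "f \<in> free_mod r" and "join r f g = (\<lambda>_. 0)"
  then have *: "join r f g l = 0" for l by simp
  have "f l = 0" for l using *[of l] f by (cases "l < r") (auto simp: join_def free_mod_def)
  moreover have "g l = 0" for l using *[of "r + l"] by (auto simp: join_def)
  ultimately show "f = (\<lambda>_. 0) \<and> g = (\<lambda>_. 0)" by auto
qed (auto simp: join_def)

lemma join_eq_iff:
  assumes "f \<in> free_mod r" "f' \<in> free_mod r"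
  shows "join r f g = join r f' g' \<longleftrightarrow> f = f' \<and> g = g'"
proof
  assume "join r f g = join r f' g'"
  then have *: "join r f g l = join r f' g' l" for l by simp
  have "f l = f' l" for l using *[of l] assms by (cases "l < r") (auto simp: join_def free_mod_def)
  moreover have "g l = g' l" for l using *[of "r + l"] by (auto simp: join_def)
  ultimately show "f = f' \<and> g = g'" by auto
qed auto

lemma free_mod_add: "f \<in> free_mod r \<Longrightarrow> g \<in> free_mod r \<Longrightarrow> (\<lambda>l. f l + (g l :: 's::comm_ring_1)) \<in> free_mod r"
  and free_mod_diff: "f \<in> free_mod r \<Longrightarrow> g \<in> free_mod r \<Longrightarrow> (\<lambda>l. f l - (g l :: 's::comm_ring_1)) \<in> free_mod r"
  and free_mod_uminus: "f \<in> free_mod r \<Longrightarrow> (\<lambda>l. - (f l :: 's::comm_ring_1)) \<in> free_mod r"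
  and unit_vector_in_free_mod: "j < r \<Longrightarrow> (unit_vector j :: nat \<Rightarrow> 's::comm_ring_1) \<in> free_mod r"
  by (auto simp: free_mod_def unit_vector_def)

lemma free_mod_one: "f \<in> free_mod (Suc 0) \<longleftrightarrow> f = first_entry (f 0)"
  by (auto simp: free_mod_def first_entry_def fun_eq_iff Suc_le_eq)

lemma first_entry_in_free_mod [simp]: "first_entry x \<in> free_mod (Suc 0)"
  by (auto simp: free_mod_def first_entry_def)

lemma first_entry_eq_iff [simp]: "first_entry x = first_entry y \<longleftrightarrow> x = y"
  by (auto simp: first_entry_def fun_eq_iff)

section \<open>Homogeneous elements and augmented resolutions\<close>

definition homogeneous ::
    "nat \<Rightarrow> (nat \<Rightarrow> 'n exponent) \<Rightarrow> 'n exponent \<Rightarrow> (nat \<Rightarrow> ('n, 'k::field) mpoly) set" where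
  "homogeneous r sh g = {f \<in> free_mod r. \<forall>l. \<forall>a\<in>keys (f l). a + sh l = g}"

lemma homogeneous_subset_free_mod: "f \<in> homogeneous r sh g \<Longrightarrow> f \<in> free_mod r"
  by (simp add: homogeneous_def)

text \<open>
  Preimages under a homogeneous map can be made homogeneous: discard from any preimage all
  terms of the wrong degree. This is what keeps the comparison maps below multigraded.
\<close>

lemma homogeneous_preimage:
  fixes M :: "nat \<Rightarrow> nat \<Rightarrow> ('n, 'k::field) mpoly"
  assumes rows: "\<And>j. j < r \<Longrightarrow> M j \<in> homogeneous s sh' (sh j)"
    and y: "y \<in> range (lin r M)" "y \<in> homogeneous s sh' g"
  shows "\<exists>x\<in>homogeneous r sh g. lin r M x = y"
proof -
  obtain f where f: "y = lin r M f" using y by blast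
  define x where "x j = (if j < r then homogeneous_part (\<lambda>a. a + sh j = g) (f j) else 0)" for j
  have "x \<in> homogeneous r sh g"
    by (auto simp: x_def homogeneous_def free_mod_def keys_homogeneous_part)
  moreover have "lin r M x = y"
  proof
    fix l
    have "lin r M x l = (\<Sum>j<r. homogeneous_part (\<lambda>c. c + sh' l = g) (f j * M j l))"
      unfolding lin_def
    proof (rule sum.cong)
      fix j assume "j \<in> {..<r}"
      then have j: "j < r" by simp
      have "homogeneous_part (\<lambda>c. c + sh' l = g) (f j * M j l)
          = homogeneous_part (\<lambda>a. a + sh j = g) (f j) * M j l"
      proof (rule homogeneous_part_mult)
        fix a c assume "c \<in> keys (M j l)"
        then have "c + sh' l = sh j" using rows[OF j] by (auto simp: homogeneous_def)
        then show "(a + c + sh' l = g) = (a + sh j = g)" by (simp add: add.assoc)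
      qed
      then show "x j * M j l = homogeneous_part (\<lambda>c. c + sh' l = g) (f j * M j l)"
        using j by (simp add: x_def)
    qed simp
    also have "\<dots> = homogeneous_part (\<lambda>c. c + sh' l = g) (y l)"
      by (simp add: f lin_def homogeneous_part_sum)
    also have "\<dots> = y l"
      using y by (intro homogeneous_part_id) (auto simp: homogeneous_def)
    finally show "lin r M x l = y l" .
  qed
  ultimately show ?thesis by blast
qed

lemma lin_homogeneous:
  fixes M :: "nat \<Rightarrow> nat \<Rightarrow> ('n, 'k::field) mpoly"
  assumes rows: "\<And>j. j < r \<Longrightarrow> M j \<in> homogeneous s sh' (sh j + u)"
    and f: "f \<in> homogeneous r sh g"
  shows "lin r M f \<in> homogeneous s sh' (g + u)"
proof -
  have "lin r M f \<in> free_mod s"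
    using rows by (intro lin_in_free_mod) (auto simp: homogeneous_def)
  moreover have "a + sh' l = g + u" if a: "a \<in> keys (lin r M f l)" for a l
  proof -
    have "\<exists>j<r. a \<in> keys (f j * M j l)"
    proof (rule ccontr)
      assume "\<not> ?thesis"
      then have "lookup (lin r M f l) a = 0"
        by (auto simp: lin_def lookup_sum in_keys_iff)
      with a show False by (simp add: in_keys_iff)
    qed
    then obtain j where j: "j < r" "a \<in> keys (f j * M j l)" by blast
    then obtain b c where bc: "a = b + c" "b \<in> keys (f j)" "c \<in> keys (M j l)"
      using keys_mult[of "f j" "M j l"] by blast
    have "b + sh j = g" "c + sh' l = sh j + u"
      using bc f rows[OF j(1)] by (auto simp: homogeneous_def)
    then show ?thesis using bc by (metis add.assoc)
  qed
  ultimately show ?thesis by (simp add: homogeneous_def)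
qed

text \<open>
  A resolution together with its augmentation, where the ring itself sits in position \<open>0\<close> and
  the module \<open>F\<^sub>i\<close> in position \<open>i + 1\<close>. Treating the augmentation as one more differential
  makes the formulas for the mapping cone uniform in all positions.
\<close>

record ('n, 's) augmented_complex =
  arank :: "nat \<Rightarrow> nat"
  ashift :: "nat \<Rightarrow> nat \<Rightarrow> 'n exponent"
  amat :: "nat \<Rightarrow> nat \<Rightarrow> nat \<Rightarrow> 's"

definition boundary ::
    "('n, 's::comm_ring_1) augmented_complex \<Rightarrow> nat \<Rightarrow> (nat \<Rightarrow> 's) \<Rightarrow> nat \<Rightarrow> 's" where
  "boundary C i = lin (arank C (Suc i)) (amat C i)"

definition augmented_resolution ::
    "('n, ('n, 'k::field) mpoly) augmented_complex \<Rightarrow> ('n, 'k) mpoly set \<Rightarrow> bool" where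
  "augmented_resolution C J \<longleftrightarrow>
     arank C 0 = 1 \<and> ashift C 0 0 = 0 \<and>
     (\<forall>i. \<forall>j<arank C (Suc i).
        amat C i j \<in> homogeneous (arank C i) (ashift C i) (ashift C (Suc i) j)) \<and>
     (\<forall>x. x \<in> J \<longleftrightarrow> first_entry x \<in> range (boundary C 0)) \<and>
     (\<forall>i. \<forall>f\<in>free_mod (arank C (Suc i)).
        boundary C i f = (\<lambda>_. 0) \<longleftrightarrow> f \<in> range (boundary C (Suc i)))"

context
  fixes C :: "('n, ('n, 'k::field) mpoly) augmented_complex" and J
  assumes C: "augmented_resolution C J"
begin

lemma augmented_resolution_bottom: "arank C 0 = Suc 0" "ashift C 0 0 = 0"
  using C by (auto simp: augmented_resolution_def)

lemma augmented_resolution_row: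
  "j < arank C (Suc i) \<Longrightarrow> amat C i j \<in> homogeneous (arank C i) (ashift C i) (ashift C (Suc i) j)"
  using C by (auto simp: augmented_resolution_def)

lemma augmented_resolution_row_free:
  "j < arank C (Suc i) \<Longrightarrow> amat C i j \<in> free_mod (arank C i)"
  using augmented_resolution_row homogeneous_subset_free_mod by blast

lemma augmented_resolution_image: "x \<in> J \<longleftrightarrow> first_entry x \<in> range (boundary C 0)"
  using C by (auto simp: augmented_resolution_def)

lemma augmented_resolution_exact:
  "f \<in> free_mod (arank C (Suc i)) \<Longrightarrow>
    boundary C i f = (\<lambda>_. 0) \<longleftrightarrow> f \<in> range (boundary C (Suc i))"
  using C by (auto simp: augmented_resolution_def)

lemma boundary_in_free_mod: "boundary C i f \<in> free_mod (arank C i)"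
  unfolding boundary_def by (intro lin_in_free_mod augmented_resolution_row_free)

lemma boundary_boundary: "boundary C i (boundary C (Suc i) f) = (\<lambda>_. 0)"
  using augmented_resolution_exact[OF boundary_in_free_mod, of i f] by blast

lemma row_is_boundary: "j < arank C (Suc i) \<Longrightarrow> amat C i j = boundary C i (unit_vector j)"
  by (simp add: boundary_def lin_unit_vector)

end

section \<open>The mapping cone\<close>

text \<open>
  A chain map from \<open>E\<close> to \<open>C\<close> that raises multidegrees by \<open>u\<close> and is multiplication by
  \<open>x\<^sup>u\<close> on the ring in position \<open>0\<close>.
\<close>

definition comparison_map ::
    "'n exponent \<Rightarrow> ('n, ('n, 'k::field) mpoly) augmented_complex
      \<Rightarrow> ('n, ('n, 'k) mpoly) augmented_complex \<Rightarrow> (nat \<Rightarrow> nat \<Rightarrow> nat \<Rightarrow> ('n, 'k) mpoly) \<Rightarrow> bool" where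
  "comparison_map u E C \<phi> \<longleftrightarrow>
     \<phi> 0 0 = first_entry (monomial u) \<and>
     (\<forall>i. \<forall>j<arank E i. \<phi> i j \<in> homogeneous (arank C i) (ashift C i) (ashift E i j + u)) \<and>
     (\<forall>i. \<forall>j<arank E (Suc i). boundary C i (\<phi> (Suc i) j) = lin (arank E i) (\<phi> i) (amat E i j))"

text \<open>
  The usual lifting argument. It starts because \<open>x\<^sup>u\<close> maps the colon ideal into \<open>J\<close>, and it
  continues because \<open>C\<close> is exact. The invariant of the recursion is that the lift constructed
  so far sends boundaries of \<open>E\<close> to boundaries of \<open>C\<close>.
\<close>

lemma comparison_map_exists:
  fixes C E :: "('n, ('n, 'k::field) mpoly) augmented_complex"
  assumes C: "augmented_resolution C J"
    and E: "augmented_resolution E (colon_monomial J u)"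
  shows "\<exists>\<phi>. comparison_map u E C \<phi>"
proof -
  define P where "P i M \<longleftrightarrow>
      (\<forall>j<arank E i. M j \<in> homogeneous (arank C i) (ashift C i) (ashift E i j + u)) \<and>
      (\<forall>j<arank E (Suc i). lin (arank E i) M (amat E i j) \<in> range (boundary C i)) \<and>
      (i = 0 \<longrightarrow> M 0 = first_entry (monomial u))" for i M
  define Q where "Q i M N \<longleftrightarrow>
      (\<forall>j<arank E (Suc i). boundary C i (N j) = lin (arank E i) M (amat E i j))" for i M N
  have "\<exists>\<phi>. \<forall>i. P i (\<phi> i) \<and> Q i (\<phi> i) (\<phi> (Suc i))"
  proof (rule dependent_nat_choice)
    let ?M = "\<lambda>_::nat. first_entry (monomial u :: ('n, 'k) mpoly)"
    have "lin (arank E 0) ?M (amat E 0 j) \<in> range (boundary C 0)" if j: "j < arank E (Suc 0)" for j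
    proof -
      obtain x where x: "amat E 0 j = first_entry x"
        using augmented_resolution_row_free[OF E j] augmented_resolution_bottom[OF E]
          free_mod_one by metis
      have "first_entry x \<in> range (boundary E 0)"
        using row_is_boundary[OF E j] x by auto
      then have "x * monomial u \<in> J"
        using augmented_resolution_image[OF E] by (auto simp: colon_monomial_def)
      then have "first_entry (x * monomial u) \<in> range (boundary C 0)"
        using augmented_resolution_image[OF C] by blast
      moreover have "lin (arank E 0) ?M (amat E 0 j) = first_entry (x * monomial u)"
        by (auto simp: augmented_resolution_bottom[OF E] lin_def x first_entry_def)
      ultimately show ?thesis by simp
    qed
    then have "P 0 ?M"
      unfolding P_def using augmented_resolution_bottom[OF E] augmented_resolution_bottom[OF C]
      by (auto simp: homogeneous_def) (auto simp: first_entry_def monomial_def split: if_splits)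
    then show "\<exists>M. P 0 M" by (intro exI[of "P 0" ?M])
  next
    fix M i assume M: "P i M"
    have "\<exists>x. x \<in> homogeneous (arank C (Suc i)) (ashift C (Suc i)) (ashift E (Suc i) j + u)
        \<and> boundary C i x = lin (arank E i) M (amat E i j)" if j: "j < arank E (Suc i)" for j
    proof -
      have "lin (arank E i) M (amat E i j)
          \<in> homogeneous (arank C i) (ashift C i) (ashift E (Suc i) j + u)"
        by (rule lin_homogeneous[OF _ augmented_resolution_row[OF E j]]) (use M in \<open>auto simp: P_def\<close>)
      moreover have "lin (arank E i) M (amat E i j) \<in> range (boundary C i)"
        using M j by (auto simp: P_def)
      ultimately show ?thesis
        unfolding boundary_def
        using homogeneous_preimage[where M = "amat C i" and sh = "ashift C (Suc i)",
            OF augmented_resolution_row[OF C]] by blast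
    qed
    then obtain N where N: "\<And>j. j < arank E (Suc i) \<Longrightarrow>
        N j \<in> homogeneous (arank C (Suc i)) (ashift C (Suc i)) (ashift E (Suc i) j + u)"
      "\<And>j. j < arank E (Suc i) \<Longrightarrow> boundary C i (N j) = lin (arank E i) M (amat E i j)"
      by metis
    have "lin (arank E (Suc i)) N (amat E (Suc i) j) \<in> range (boundary C (Suc i))"
      if j: "j < arank E (Suc (Suc i))" for j
    proof -
      have "boundary C i (lin (arank E (Suc i)) N (amat E (Suc i) j))
          = lin (arank E (Suc i)) (\<lambda>t. lin (arank E i) M (amat E i t)) (amat E (Suc i) j)"
        unfolding boundary_def lin_lin
        by (rule lin_cong) (use N in \<open>auto simp: boundary_def\<close>)
      also have "\<dots> = lin (arank E i) M (boundary E i (amat E (Suc i) j))"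
        unfolding boundary_def lin_lin ..
      also have "boundary E i (amat E (Suc i) j) = (\<lambda>_. 0)"
        by (simp add: row_is_boundary[OF E j] boundary_boundary[OF E])
      finally have "boundary C i (lin (arank E (Suc i)) N (amat E (Suc i) j)) = (\<lambda>_. 0)" by simp
      moreover have "lin (arank E (Suc i)) N (amat E (Suc i) j) \<in> free_mod (arank C (Suc i))"
        by (intro lin_in_free_mod homogeneous_subset_free_mod[OF N(1)])
      ultimately show ?thesis
        using augmented_resolution_exact[OF C] by blast
    qed
    then show "\<exists>N. P (Suc i) N \<and> Q i M N"
      using N unfolding P_def Q_def by blast
  qed
  then obtain \<phi> where "\<And>i. P i (\<phi> i)" "\<And>i. Q i (\<phi> i) (\<phi> (Suc i))" by blast
  then have "comparison_map u E C \<phi>"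
    unfolding comparison_map_def P_def Q_def by simp
  then show ?thesis by (intro exI[of _ \<phi>])
qed

text \<open>
  The mapping cone, with the ring in position \<open>0\<close> of \<open>E\<close> placed next to \<open>F\<^sub>0\<close>: its basis
  element is the new generator \<open>x\<^sup>u\<close>, and position \<open>h\<close> of \<open>E\<close> goes to position \<open>h + 1\<close>
  of the cone.
\<close>

definition cone ::
    "'n exponent \<Rightarrow> ('n, ('n, 'k::field) mpoly) augmented_complex
      \<Rightarrow> ('n, ('n, 'k) mpoly) augmented_complex \<Rightarrow> (nat \<Rightarrow> nat \<Rightarrow> nat \<Rightarrow> ('n, 'k) mpoly)
      \<Rightarrow> ('n, ('n, 'k) mpoly) augmented_complex" where
  "cone u E C \<phi> = \<lparr>
     arank = (\<lambda>i. case i of 0 \<Rightarrow> 1 | Suc h \<Rightarrow> arank C (Suc h) + arank E h),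
     ashift = (\<lambda>i. case i of 0 \<Rightarrow> (\<lambda>_. 0)
       | Suc h \<Rightarrow> join (arank C (Suc h)) (ashift C (Suc h)) (\<lambda>j. ashift E h j + u)),
     amat = (\<lambda>i. case i of 0 \<Rightarrow> join (arank C 1) (amat C 0) (\<phi> 0)
       | Suc h \<Rightarrow> join (arank C (Suc (Suc h))) (amat C (Suc h))
           (\<lambda>j. join (arank C (Suc h)) (\<phi> (Suc h) j) (\<lambda>l. - amat E h j l)))\<rparr>"

lemma cone_simps [simp]:
  "arank (cone u E C \<phi>) 0 = 1"
  "arank (cone u E C \<phi>) (Suc h) = arank C (Suc h) + arank E h"
  "ashift (cone u E C \<phi>) 0 j = 0"
  "ashift (cone u E C \<phi>) (Suc h) = join (arank C (Suc h)) (ashift C (Suc h)) (\<lambda>j. ashift E h j + u)"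
  "amat (cone u E C \<phi>) 0 = join (arank C 1) (amat C 0) (\<phi> 0)"
  "amat (cone u E C \<phi>) (Suc h) = join (arank C (Suc (Suc h))) (amat C (Suc h))
           (\<lambda>j. join (arank C (Suc h)) (\<phi> (Suc h) j) (\<lambda>l. - amat E h j l))"
  by (simp_all add: cone_def)

lemma boundary_cone_0:
  "boundary (cone u E C \<phi>) 0 (join (arank C 1) f g)
    = (\<lambda>l. boundary C 0 f l + lin (arank E 0) (\<phi> 0) g l)"
  by (simp add: boundary_def lin_join)

lemma boundary_cone_Suc:
  assumes "augmented_resolution C J"
  shows "boundary (cone u E C \<phi>) (Suc i) (join (arank C (Suc (Suc i))) f g)
    = join (arank C (Suc i)) (\<lambda>l. boundary C (Suc i) f l + lin (arank E (Suc i)) (\<phi> (Suc i)) g l)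
        (\<lambda>l. - boundary E i g l)"
  using add_join[OF boundary_in_free_mod[OF assms, of "Suc i" f],
      of "lin (arank E (Suc i)) (\<phi> (Suc i)) g" "\<lambda>l. - boundary E i g l"]
  by (simp add: boundary_def lin_join lin_columns_join lin_matrix_uminus)

lemma comparison_map_chain:
  assumes "comparison_map u E C \<phi>"
  shows "boundary C i (lin (arank E (Suc i)) (\<phi> (Suc i)) g) = lin (arank E i) (\<phi> i) (boundary E i g)"
  unfolding boundary_def lin_lin
  by (rule lin_cong) (use assms in \<open>auto simp: comparison_map_def boundary_def\<close>)

lemma comparison_map_free:
  assumes "comparison_map u E C \<phi>"
  shows "lin (arank E i) (\<phi> i) g \<in> free_mod (arank C i)"
  by (rule lin_in_free_mod) (use assms in \<open>auto simp: comparison_map_def homogeneous_def\<close>)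

text \<open>
  Adding a generator \<open>x\<^sup>u\<close> to \<open>J\<close> creates one new relation \<open>s x\<^sup>u \<in> J\<close> for each \<open>s\<close> in the
  colon ideal, and the relations among these are resolved by \<open>E\<close>. A cycle \<open>(f, g)\<close> of the
  cone first has \<open>g\<close> written as a boundary of \<open>E\<close>; at the bottom this uses the definition of
  the colon ideal, above it the exactness of \<open>E\<close>. Subtracting the comparison map turns \<open>f\<close>
  into a cycle of \<open>C\<close>.
\<close>

lemma cone_resolution:
  fixes C E :: "('n, ('n, 'k::field) mpoly) augmented_complex"
  assumes C: "augmented_resolution C J"
    and E: "augmented_resolution E (colon_monomial J u)"
    and \<phi>: "comparison_map u E C \<phi>"
  shows "augmented_resolution (cone u E C \<phi>) {f + s * monomial u | f s. f \<in> J}"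
proof -
  let ?H = "cone u E C \<phi>"
  note bC = augmented_resolution_bottom[OF C] and bE = augmented_resolution_bottom[OF E]
  have \<phi>0: "lin (arank E 0) (\<phi> 0) g = first_entry (g 0 * monomial u)" for g
    using \<phi> by (auto simp: bE lin_def comparison_map_def first_entry_def)
  have \<phi>hom: "\<phi> i j \<in> homogeneous (arank C i) (ashift C i) (ashift E i j + u)" if "j < arank E i" for i j
    using \<phi> that by (auto simp: comparison_map_def)
  have free: "amat ?H i j \<in> free_mod (arank ?H i)" if "j < arank ?H (Suc i)" for i j
  proof (cases i)
    case 0
    then show ?thesis
      using that augmented_resolution_row_free[OF C, of j 0] \<phi>hom[of "j - arank C 1" 0] bC bE
      by (auto simp: join_def homogeneous_def)
  next
    case (Suc h)
    have "amat C (Suc h) j \<in> free_mod (arank C (Suc h) + arank E h)" if "j < arank C (Suc (Suc h))"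
      using augmented_resolution_row_free[OF C that] by (auto simp: free_mod_def)
    moreover have "join (arank C (Suc h)) (\<phi> (Suc h) j') (\<lambda>l. - amat E h j' l)
        \<in> free_mod (arank C (Suc h) + arank E h)" if "j' < arank E (Suc h)" for j'
      using augmented_resolution_row_free[OF E that] by (intro join_in_free_mod free_mod_uminus)
    ultimately show ?thesis using that Suc by (simp add: join_def[of "arank C (Suc (Suc h))"])
  qed
  have hom: "amat ?H i j \<in> homogeneous (arank ?H i) (ashift ?H i) (ashift ?H (Suc i) j)"
    if j: "j < arank ?H (Suc i)" for i j
  proof -
    have "a + ashift ?H i l = ashift ?H (Suc i) j" if a: "a \<in> keys (amat ?H i j l)" for a l
    proof (cases i)
      case 0
      have l: "l = 0"
        using free[OF j] a 0 by (cases l) (auto simp: free_mod_def)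
      show ?thesis
      proof (cases "j < arank C 1")
        case True
        then show ?thesis
          using augmented_resolution_row[OF C, of j 0] a bC unfolding 0 l
          by (auto simp: homogeneous_def join_def) (metis add_0_right)
      next
        case False
        then have "j - arank C 1 = 0" using j 0 bE by simp
        then show ?thesis
          using \<phi>hom[of 0 0] a bC bE False unfolding 0 l
          by (auto simp: homogeneous_def join_def) (metis add_0_right)
      qed
    next
      case (Suc h)
      show ?thesis
      proof (cases "j < arank C (Suc (Suc h))")
        case True
        then have "l < arank C (Suc h)"
          using a augmented_resolution_row_free[OF C True] unfolding Suc
          by (auto simp: join_def free_mod_def) (metis keys_zero empty_iff not_le)
        then show ?thesis
          using augmented_resolution_row[OF C True] a True unfolding Suc
          by (auto simp: homogeneous_def join_def)
      next
        case False
        define j' where "j' = j - arank C (Suc (Suc h))"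
        have j': "j' < arank E (Suc h)" "join (arank C (Suc (Suc h))) X Y j = Y j'"
          for X Y :: "nat \<Rightarrow> 'z" using False j Suc by (auto simp: j'_def join_def)
        have j'': "amat ?H i j = join (arank C (Suc h)) (\<phi> (Suc h) j') (\<lambda>l. - amat E h j' l)"
          "ashift ?H (Suc i) j = ashift E (Suc h) j' + u"
          using False by (auto simp: Suc join_def j'_def)
        show ?thesis
        proof (cases "l < arank C (Suc h)")
          case True
          then show ?thesis
            using \<phi>hom[OF j'(1)] a unfolding j'' by (auto simp: Suc homogeneous_def join_def)
        next
          case False
          then have "a \<in> keys (amat E h j' (l - arank C (Suc h)))"
            using a unfolding j'' by (auto simp: join_def in_keys_iff)
          then have "a + ashift E h (l - arank C (Suc h)) = ashift E (Suc h) j'"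
            using augmented_resolution_row[OF E j'(1)] by (auto simp: homogeneous_def)
          then show ?thesis
            using False unfolding j'' by (simp add: Suc join_def flip: add.assoc)
        qed
      qed
    qed
    then show ?thesis using free[OF j] by (simp add: homogeneous_def)
  qed
  have img: "x \<in> {f + s * monomial u | f s. f \<in> J} \<longleftrightarrow> first_entry x \<in> range (boundary ?H 0)" for x
  proof
    assume "x \<in> {f + s * monomial u | f s. f \<in> J}"
    then obtain f s where x: "x = f + s * monomial u" "f \<in> J" by blast
    then obtain f' where f': "boundary C 0 f' = first_entry f"
      using augmented_resolution_image[OF C, of f] by force
    have "boundary ?H 0 (join (arank C 1) f' (first_entry s)) = first_entry x"
      unfolding boundary_cone_0 f' \<phi>0 x by (auto simp: first_entry_def)
    then show "first_entry x \<in> range (boundary ?H 0)" by (metis rangeI)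
  next
    assume "first_entry x \<in> range (boundary ?H 0)"
    then obtain h where "first_entry x = boundary ?H 0 h" by blast
    also have "\<dots> = boundary ?H 0 (join (arank C 1) h (\<lambda>l. h (arank C 1 + l)))"
      by (simp only: join_split)
    finally have eq: "first_entry x l = boundary C 0 h l + first_entry (h (arank C 1) * monomial u) l" for l
      by (simp add: boundary_cone_0[simplified] \<phi>0)
    have "boundary C 0 h = first_entry (boundary C 0 h 0)"
      using boundary_in_free_mod[OF C, of 0 h] unfolding bC free_mod_one .
    then have "boundary C 0 h 0 \<in> J"
      using augmented_resolution_image[OF C] by (metis rangeI)
    moreover have "x = boundary C 0 h 0 + h (arank C 1) * monomial u"
      using eq[of 0] by (simp add: first_entry_def)
    ultimately show "x \<in> {f + s * monomial u | f s. f \<in> J}" by blast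
  qed
  have cycle_boundary: "boundary ?H i f = (\<lambda>_. 0) \<longleftrightarrow> f \<in> range (boundary ?H (Suc i))"
    if ff: "f \<in> free_mod (arank ?H (Suc i))" for i f
  proof -
    define r where "r = arank C (Suc i)"
    define f1 where "f1 = (\<lambda>l. if l < r then f l else 0)"
    define f2 where "f2 = (\<lambda>l. f (r + l))"
    have f: "f = join r f1 f2" by (auto simp: f1_def f2_def join_def)
    have f1: "f1 \<in> free_mod r" by (auto simp: f1_def free_mod_def)
    have f2: "f2 \<in> free_mod (arank E i)" using ff unfolding f2_def r_def by (auto simp: free_mod_def)
    \<comment> \<open>At \<open>i = 0\<close> the component in \<open>E\<close> has no boundary inside the cone, so it contributes
      no condition.\<close>
    have cyc: "boundary ?H i f = (\<lambda>_. 0) \<longleftrightarrow>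
        (\<forall>l. boundary C i f1 l + lin (arank E i) (\<phi> i) f2 l = 0) \<and>
        (\<forall>h. i = Suc h \<longrightarrow> boundary E h f2 = (\<lambda>_. 0))"
    proof (cases i)
      case 0
      then show ?thesis unfolding f r_def using boundary_cone_0[of u E C \<phi> f1 f2]
        by (auto simp: fun_eq_iff)
    next
      case (Suc h)
      have "(\<lambda>l. boundary C (Suc h) f1 l + lin (arank E (Suc h)) (\<phi> (Suc h)) f2 l) \<in> free_mod (arank C (Suc h))"
        by (intro free_mod_add boundary_in_free_mod[OF C] comparison_map_free[OF \<phi>])
      then show ?thesis unfolding f r_def Suc boundary_cone_Suc[OF C]
        by (subst join_eq_zero) (auto simp: fun_eq_iff)
    qed
    show ?thesis
    proof
      assume "boundary ?H i f = (\<lambda>_. 0)"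
      with cyc have 1: "boundary C i f1 l + lin (arank E i) (\<phi> i) f2 l = 0" for l by blast
      have "f2 \<in> range (boundary E i)"
      proof (cases i)
        case 0
        have "first_entry (- f2 0 * monomial u) = boundary C 0 f1"
        proof
          fix l
          show "first_entry (- f2 0 * monomial u) l = boundary C 0 f1 l"
            using 1[of l] unfolding 0 \<phi>0
            by (auto simp: first_entry_def add_eq_0_iff split: if_splits)
        qed
        then have "- f2 0 * monomial u \<in> J" using augmented_resolution_image[OF C] by (metis rangeI)
        then have "- f2 0 \<in> colon_monomial J u" by (simp add: colon_monomial_def)
        then obtain g where g: "boundary E 0 g = first_entry (- f2 0)"
          using augmented_resolution_image[OF E] by force
        have "f2 = first_entry (f2 0)" using f2 unfolding 0 bE free_mod_one .
        also have "\<dots> = boundary E 0 (\<lambda>l. - g l)"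
          using g by (auto simp: boundary_def lin_uminus first_entry_def)
        finally show ?thesis using 0 by auto
      next
        case (Suc h)
        then show ?thesis
          using cyc \<open>boundary ?H i f = (\<lambda>_. 0)\<close> augmented_resolution_exact[OF E, of f2 h] f2 by auto
      qed
      then obtain g where g: "f2 = boundary E i g" by blast
      let ?f1' = "\<lambda>l. f1 l + lin (arank E (Suc i)) (\<phi> (Suc i)) g l"
      have "boundary C i ?f1' = (\<lambda>l. boundary C i f1 l + boundary C i (lin (arank E (Suc i)) (\<phi> (Suc i)) g) l)"
        by (simp add: boundary_def lin_add)
      also have "\<dots> = (\<lambda>_. 0)" unfolding comparison_map_chain[OF \<phi>] g[symmetric] using 1 by auto
      finally have "boundary C i ?f1' = (\<lambda>_. 0)" .
      moreover have "?f1' \<in> free_mod (arank C (Suc i))"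
        using f1 unfolding r_def by (intro free_mod_add comparison_map_free[OF \<phi>])
      ultimately obtain g1 where g1: "?f1' = boundary C (Suc i) g1"
        using augmented_resolution_exact[OF C] by blast
      have "boundary ?H (Suc i) (join (arank C (Suc (Suc i))) g1 (\<lambda>l. - g l)) = f"
        unfolding boundary_cone_Suc[OF C] f r_def g1[symmetric]
        by (simp add: lin_uminus boundary_def g)
      then show "f \<in> range (boundary ?H (Suc i))" by (metis rangeI)
    next
      assume "f \<in> range (boundary ?H (Suc i))"
      then obtain h where "f = boundary ?H (Suc i) h" by blast
      also have "\<dots> = boundary ?H (Suc i) (join (arank C (Suc (Suc i))) h (\<lambda>l. h (arank C (Suc (Suc i)) + l)))"
        by (simp only: join_split)
      finally obtain g where fg: "join r f1 f2 = join r (\<lambda>l. boundary C (Suc i) h l + lin (arank E (Suc i)) (\<phi> (Suc i)) g l)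
          (\<lambda>l. - boundary E i g l)"
        unfolding boundary_cone_Suc[OF C] f r_def by blast
      have "(\<lambda>l. boundary C (Suc i) h l + lin (arank E (Suc i)) (\<phi> (Suc i)) g l) \<in> free_mod r"
        unfolding r_def by (intro free_mod_add boundary_in_free_mod[OF C] comparison_map_free[OF \<phi>])
      with fg f1 have f12: "f1 = (\<lambda>l. boundary C (Suc i) h l + lin (arank E (Suc i)) (\<phi> (Suc i)) g l)"
        "f2 = (\<lambda>l. - boundary E i g l)" by (auto simp: join_eq_iff)
      have "boundary C i f1 = (\<lambda>l. boundary C i (boundary C (Suc i) h) l + boundary C i (lin (arank E (Suc i)) (\<phi> (Suc i)) g) l)"
        unfolding f12 by (simp add: boundary_def lin_add)
      then have "boundary C i f1 = lin (arank E i) (\<phi> i) (boundary E i g)"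
        by (simp add: boundary_boundary[OF C] comparison_map_chain[OF \<phi>])
      moreover have "lin (arank E i) (\<phi> i) f2 = (\<lambda>l. - lin (arank E i) (\<phi> i) (boundary E i g) l)"
        unfolding f12 by (simp add: lin_uminus)
      moreover have "boundary E h f2 = (\<lambda>_. 0)" if "i = Suc h" for h
        using boundary_boundary[OF E, of h g] unfolding f12 that
        by (simp add: lin_uminus boundary_def)
      ultimately show "boundary ?H i f = (\<lambda>_. 0)" unfolding cyc by auto
    qed
  qed
  show ?thesis
    unfolding augmented_resolution_def using hom img cycle_boundary by simp
qed

section \<open>Tor and the ranks of a minimal resolution\<close>

text \<open>
  The matrix of a differential after tensoring with \<open>K\<close>.
\<close>

definition constant_terms :: "(nat \<Rightarrow> nat \<Rightarrow> ('n, 'k::field) mpoly) \<Rightarrow> nat \<Rightarrow> nat \<Rightarrow> 'k" where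
  "constant_terms M = (\<lambda>j l. lookup (M j l) 0)"

lemma lookup_mult_0:
  fixes f g :: "('n, 'k::field) mpoly"
  shows "lookup (f * g) 0 = lookup f 0 * lookup g 0"
proof -
  let ?f0 = "homogeneous_part (\<lambda>a. a = 0) f" and ?g0 = "homogeneous_part (\<lambda>a. a = 0) g"
  let ?f1 = "homogeneous_part (\<lambda>a. a \<noteq> 0) f" and ?g1 = "homogeneous_part (\<lambda>a. a \<noteq> 0) g"
  have sum0: "a = 0" if "a + b = 0" for a b :: "'n exponent"
    using that by (metis add_is_0 lookup_add lookup_zero poly_mapping_eqI)
  have 1: "lookup (?f1 * h) 0 = 0" for h
    using keys_mult[of ?f1 h] sum0 by (fastforce simp: keys_homogeneous_part in_keys_iff)
  have 2: "lookup (h * ?g1) 0 = 0" for h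
    using keys_mult[of h ?g1] sum0
    by (fastforce simp: keys_homogeneous_part in_keys_iff add.commute)
  have f0: "?f0 = Poly_Mapping.single 0 (lookup f 0)" and g0: "?g0 = Poly_Mapping.single 0 (lookup g 0)"
    by (auto intro!: poly_mapping_eqI simp: lookup_homogeneous_part lookup_single when_def)
  have "f * g = ?f0 * g + ?f1 * g"
    by (simp only: distrib_right[symmetric] homogeneous_part_split[of f "\<lambda>a. a = 0", symmetric])
  moreover have "?f0 * g = ?f0 * ?g0 + ?f0 * ?g1"
    by (simp only: distrib_left[symmetric] homogeneous_part_split[of g "\<lambda>a. a = 0", symmetric])
  ultimately have "f * g = ?f0 * ?g0 + ?f0 * ?g1 + ?f1 * g" by simp
  then show ?thesis
    by (simp add: lookup_add 1 2) (simp add: f0 g0 mult_single)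
qed

lemma constant_terms_lin:
  "lookup (lin r M f l) 0 = lin r (constant_terms M) (\<lambda>j. lookup (f j) 0) l"
  by (simp add: lin_def lookup_sum lookup_mult_0 constant_terms_def)

lemma constant_term_degrees:
  assumes "f \<in> homogeneous r sh g" "lookup (f l) 0 \<noteq> 0"
  shows "sh l = g \<and> l < r"
proof
  have "0 \<in> keys (f l)" using assms(2) by (simp add: in_keys_iff)
  then have "0 + sh l = g" using assms(1) unfolding homogeneous_def by blast
  then show "sh l = g" by simp
  show "l < r"
    using assms by (cases "l < r") (auto simp: homogeneous_def free_mod_def)
qed

text \<open>
  A resolution of the unit ideal is an exact complex of free modules that ends in position
  \<open>0\<close>, so it has a contracting homotopy. Only one step of it is needed: maps \<open>h\<close> and \<open>x\<close>
  with \<open>d x = 1 - h d\<close>. The condition \<open>d h d = d\<close> on \<open>h\<close> is what makes \<open>1 - h d\<close> land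
  in the cycles, and it is inherited by \<open>x\<close>, so that the induction can proceed.
\<close>

lemma partial_contraction:
  assumes C: "augmented_resolution C (UNIV :: ('n, 'k::field) mpoly set)"
  shows "\<exists>h x. \<forall>j<arank C (Suc i).
      boundary C (Suc i) (x j) = (\<lambda>l. unit_vector j l - lin (arank C i) h (amat C i j) l)"
proof -
  have step: "\<exists>x. \<forall>j<arank C (Suc i).
      boundary C (Suc i) (x j) = (\<lambda>l. unit_vector j l - lin (arank C i) h (amat C i j) l)"
    if h: "\<forall>f. boundary C i (lin (arank C i) h (boundary C i f)) = boundary C i f"
      and hf: "\<forall>j<arank C i. h j \<in> free_mod (arank C (Suc i))" for i h
  proof -
    have "\<exists>x. boundary C (Suc i) x = (\<lambda>l. unit_vector j l - lin (arank C i) h (amat C i j) l)"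
      if j: "j < arank C (Suc i)" for j
    proof -
      let ?v = "\<lambda>l. unit_vector j l - lin (arank C i) h (amat C i j) l"
      have "boundary C i ?v = (\<lambda>_. 0)"
        using h unfolding row_is_boundary[OF C j] by (simp add: boundary_def lin_diff)
      moreover have "?v \<in> free_mod (arank C (Suc i))"
        using j hf by (intro free_mod_diff unit_vector_in_free_mod lin_in_free_mod) auto
      ultimately have "?v \<in> range (boundary C (Suc i))"
        using augmented_resolution_exact[OF C, of ?v i] by simp
      then obtain x where x: "?v = boundary C (Suc i) x" by (rule rangeE)
      show ?thesis by (rule exI[of _ x], rule x[symmetric])
    qed
    then have "\<forall>j. \<exists>x. j < arank C (Suc i) \<longrightarrow> boundary C (Suc i) x
        = (\<lambda>l. unit_vector j l - lin (arank C i) h (amat C i j) l)" by blast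
    from choice[OF this] show ?thesis .
  qed
  \<comment> \<open>The values of \<open>h\<close> may be cut down to the free module without changing \<open>d h\<close>.\<close>
  have restrict: "\<exists>h'. (\<forall>j. h' j \<in> free_mod r) \<and> (\<forall>f. lin r M (lin s h' f) = lin r M (lin s h f))"
    for M and h :: "nat \<Rightarrow> nat \<Rightarrow> ('n, 'k) mpoly" and r s
  proof (intro exI conjI allI)
    show "(\<lambda>l. if l < r then h j l else 0) \<in> free_mod r" for j by (auto simp: free_mod_def)
    show "lin r M (lin s (\<lambda>j l. if l < r then h j l else 0) f) = lin r M (lin s h f)" for f
      by (rule lin_cong) (auto simp: lin_def)
  qed
  have ex: "\<exists>h. (\<forall>j. h j \<in> free_mod (arank C (Suc i))) \<and>
      (\<forall>f. boundary C i (lin (arank C i) h (boundary C i f)) = boundary C i f)" for i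
  proof (induction i)
    case 0
    obtain f0 where f0: "boundary C 0 f0 = first_entry 1"
      using augmented_resolution_image[OF C, of 1] by force
    have "boundary C 0 (lin (arank C 0) (\<lambda>_. f0) (boundary C 0 f)) = boundary C 0 f" for f
    proof -
      define y where "y = boundary C 0 f"
      have y: "y = first_entry (y 0)"
        using boundary_in_free_mod[OF C, of 0 f]
        unfolding augmented_resolution_bottom[OF C] free_mod_one y_def .
      have "lin (arank C 0) (\<lambda>_. f0) y = (\<lambda>l. y 0 * f0 l)"
        by (simp add: augmented_resolution_bottom[OF C] lin_def)
      then have "boundary C 0 (lin (arank C 0) (\<lambda>_. f0) y) = (\<lambda>l. y 0 * boundary C 0 f0 l)"
        by (simp add: boundary_def lin_scale)
      also have "\<dots> = first_entry (y 0)" by (auto simp: f0 first_entry_def)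
      finally show ?thesis using y by (simp add: y_def)
    qed
    then show ?case
      using restrict[of "arank C (Suc 0)" "amat C 0" "arank C 0" "\<lambda>_. f0"]
      unfolding boundary_def by metis
  next
    case (Suc i)
    then obtain h where h: "\<forall>j. h j \<in> free_mod (arank C (Suc i))"
      "\<forall>f. boundary C i (lin (arank C i) h (boundary C i f)) = boundary C i f" by blast
    obtain x where x: "\<forall>j<arank C (Suc i).
      boundary C (Suc i) (x j) = (\<lambda>l. unit_vector j l - lin (arank C i) h (amat C i j) l)"
      using step[OF h(2)] h(1) by blast
    have "boundary C (Suc i) (lin (arank C (Suc i)) x (boundary C (Suc i) f)) = boundary C (Suc i) f" for f
    proof -
      let ?y = "boundary C (Suc i) f"
      have "boundary C (Suc i) (lin (arank C (Suc i)) x ?y)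
          = lin (arank C (Suc i)) (\<lambda>j l. unit_vector j l - lin (arank C i) h (amat C i j) l) ?y"
        using x by (simp add: boundary_def[of C "Suc i"] lin_lin) (intro lin_cong; simp)
      also have "\<dots> = (\<lambda>l. ?y l - lin (arank C i) h (boundary C i ?y) l)"
        by (simp add: lin_matrix_diff lin_to_unit_vectors boundary_in_free_mod[OF C])
          (simp add: boundary_def lin_lin)
      also have "\<dots> = ?y" by (simp add: boundary_boundary[OF C])
      finally show ?thesis .
    qed
    then show ?case
      using restrict[of "arank C (Suc (Suc i))" "amat C (Suc i)" "arank C (Suc i)" x]
      unfolding boundary_def by metis
  qed
  obtain h where h: "\<forall>j. h j \<in> free_mod (arank C (Suc i))"
    "\<forall>f. boundary C i (lin (arank C i) h (boundary C i f)) = boundary C i f"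
    using ex[of i] by blast
  show "\<exists>h x. \<forall>j<arank C (Suc i).
      boundary C (Suc i) (x j) = (\<lambda>l. unit_vector j l - lin (arank C i) h (amat C i j) l)"
    by (rule exI[of _ h], rule step[OF h(2)]) (use h(1) in blast)
qed

text \<open>
  The identity \<open>d x + h d = 1\<close> survives passing to constant terms.
\<close>

lemma unit_ideal_tensor_exact:
  assumes C: "augmented_resolution C (UNIV :: ('n, 'k::field) mpoly set)"
    and z: "z \<in> free_mod (arank C (Suc i))"
      "lin (arank C (Suc i)) (constant_terms (amat C i)) z = (\<lambda>_. 0)"
  shows "\<exists>y. z = lin (arank C (Suc (Suc i))) (constant_terms (amat C (Suc i))) y"
proof -
  obtain h x where hx: "\<And>j. j < arank C (Suc i) \<Longrightarrow>
      boundary C (Suc i) (x j) = (\<lambda>l. unit_vector j l - lin (arank C i) h (amat C i j) l)"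
    using partial_contraction[OF C] by metis
  have unit: "lookup (unit_vector j l :: ('n, 'k) mpoly) 0 = unit_vector j l" for j l
    by (simp add: unit_vector_def)
  let ?D = "\<lambda>i. constant_terms (amat C i)"
  have row: "lin (arank C (Suc (Suc i))) (?D (Suc i)) (constant_terms x j)
      = (\<lambda>l. unit_vector j l - lin (arank C i) (constant_terms h) (?D i j) l)"
    if j: "j < arank C (Suc i)" for j
  proof
    fix l
    have "lookup (boundary C (Suc i) (x j) l) 0
        = lookup (unit_vector j l - lin (arank C i) h (amat C i j) l) 0"
      by (simp add: hx[OF j])
    then show "lin (arank C (Suc (Suc i))) (?D (Suc i)) (constant_terms x j) l
      = unit_vector j l - lin (arank C i) (constant_terms h) (?D i j) l"
      unfolding boundary_def constant_terms_lin lookup_minus unit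
      by (simp add: constant_terms_def)
  qed
  have "lin (arank C (Suc (Suc i))) (?D (Suc i)) (lin (arank C (Suc i)) (constant_terms x) z)
      = lin (arank C (Suc i)) (\<lambda>j l. unit_vector j l - lin (arank C i) (constant_terms h) (?D i j) l) z"
    unfolding lin_lin by (rule lin_cong) (auto simp: row)
  also have "\<dots> = (\<lambda>l. z l - lin (arank C i) (constant_terms h) (lin (arank C (Suc i)) (?D i) z) l)"
    using z(1) by (simp add: lin_matrix_diff lin_to_unit_vectors lin_lin)
  also have "\<dots> = z" by (simp add: z(2))
  finally show ?thesis by metis
qed

text \<open>
  The comparison of two resolutions of the same ideal, which makes \<open>Tor\<close> independent of the
  resolution: if \<open>C\<close> has no basis element of degree \<open>a\<close> in a position, then \<open>E\<close> has no
  homology in degree \<open>a\<close> there after tensoring with \<open>K\<close>. The cone of a comparison map for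
  \<open>u = 0\<close> resolves \<open>J + (1)\<close>, the unit ideal, so it stays exact over \<open>K\<close>. A cycle \<open>z\<close>
  of \<open>E\<close> in degree \<open>a\<close> is mapped to \<open>C\<close> in degree \<open>a\<close>, hence to \<open>0\<close>, and becomes a cycle
  of the cone, one position higher; a preimage of it in the cone contains a preimage of \<open>z\<close>
  in \<open>E\<close>.
\<close>

lemma tensor_cycle_is_boundary:
  fixes C E :: "('n, ('n, 'k::field) mpoly) augmented_complex"
  assumes C: "augmented_resolution C J" and E: "augmented_resolution E J"
    and no: "\<And>j. j < arank C (Suc i) \<Longrightarrow> ashift C (Suc i) j \<noteq> a"
    and z: "z \<in> free_mod (arank E (Suc i))" "\<And>j. z j \<noteq> 0 \<Longrightarrow> ashift E (Suc i) j = a"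
      "i > 0 \<Longrightarrow> lin (arank E (Suc i)) (constant_terms (amat E i)) z = (\<lambda>_. 0)"
  shows "\<exists>y\<in>free_mod (arank E (Suc (Suc i))).
    (\<forall>j. y j \<noteq> 0 \<longrightarrow> ashift E (Suc (Suc i)) j = a) \<and>
    z = lin (arank E (Suc (Suc i))) (constant_terms (amat E (Suc i))) y"
proof -
  have one: "monomial 0 = (1 :: ('n, 'k) mpoly)" by (simp add: monomial_def)
  have "colon_monomial J 0 = J" by (simp add: colon_monomial_def one)
  with E have E': "augmented_resolution E (colon_monomial J 0)" by simp
  obtain \<phi> where \<phi>: "comparison_map 0 E C \<phi>"
    using comparison_map_exists[OF C E'] by blast
  let ?H = "cone 0 E C \<phi>"
  have zero: "0 \<in> J"
  proof -
    have "first_entry 0 = boundary C 0 (\<lambda>_. 0)"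
      by (simp add: first_entry_def boundary_def)
    then show ?thesis using augmented_resolution_image[OF C, of 0] by simp
  qed
  have "x \<in> {f + s * monomial 0 | f s. f \<in> J}" for x
    using zero by (intro CollectI exI[of _ 0] exI[of _ x]) (simp add: one)
  then have "{f + s * monomial 0 | f s. f \<in> J} = UNIV" by blast
  with cone_resolution[OF C E' \<phi>] have H: "augmented_resolution ?H UNIV" by simp
  define r where "r = arank C (Suc (Suc i))"
  define w where "w = join r (\<lambda>_. 0) z"
  have w: "w \<in> free_mod (arank ?H (Suc (Suc i)))"
    using z(1) by (simp add: w_def r_def)
  have ct_join: "constant_terms (join r A B) = join r (constant_terms A) (constant_terms B)"
    for r A B by (auto simp: constant_terms_def join_def fun_eq_iff)
  have ct_join': "constant_terms (\<lambda>j. join r (A j) (\<lambda>l. - B j l))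
      = (\<lambda>j. join r (constant_terms A j) (\<lambda>l. - constant_terms B j l))"
    for r and A B :: "nat \<Rightarrow> nat \<Rightarrow> ('n, 'k) mpoly" by (auto simp: constant_terms_def join_def fun_eq_iff)
  have bd: "lin (arank ?H (Suc (Suc h))) (constant_terms (amat ?H (Suc h))) (join (arank C (Suc (Suc h))) f g)
      = (\<lambda>l. lin (arank C (Suc (Suc h))) (constant_terms (amat C (Suc h))) f l +
         join (arank C (Suc h)) (lin (arank E (Suc h)) (constant_terms (\<phi> (Suc h))) g)
           (\<lambda>l. - lin (arank E (Suc h)) (constant_terms (amat E h)) g l) l)" for h f g
    by (simp add: ct_join lin_join ct_join' lin_columns_join lin_matrix_uminus)
  have \<phi>z: "lin (arank E (Suc i)) (constant_terms (\<phi> (Suc i))) z = (\<lambda>_. 0)"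
  proof
    fix l
    have "z j * constant_terms (\<phi> (Suc i)) j l = 0" if j: "j < arank E (Suc i)" for j
    proof (rule ccontr)
      assume "\<not> ?thesis"
      then have nz: "z j \<noteq> 0" "lookup (\<phi> (Suc i) j l) 0 \<noteq> 0" by (auto simp: constant_terms_def)
      have "\<phi> (Suc i) j \<in> homogeneous (arank C (Suc i)) (ashift C (Suc i)) (ashift E (Suc i) j + 0)"
        using \<phi> j by (auto simp: comparison_map_def)
      from constant_term_degrees[OF this nz(2)] z(2)[OF nz(1)] no show False by auto
    qed
    then show "lin (arank E (Suc i)) (constant_terms (\<phi> (Suc i))) z l = 0"
      by (simp add: lin_def del: mult_eq_0_iff)
  qed
  \<comment> \<open>For \<open>i = 0\<close> this says that the augmentation of \<open>E\<close> kills \<open>z\<close> modulo the variables.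
    Otherwise \<open>a = 0\<close> and \<open>J\<close> contains an element with nonzero constant term, so that \<open>C\<close>
    needs a generator of degree \<open>0\<close>.\<close>
  have Ez: "lin (arank E (Suc i)) (constant_terms (amat E i)) z = (\<lambda>_. 0)"
  proof (cases "i > 0")
    case False
    have "z j * constant_terms (amat E 0) j l = 0" if j: "j < arank E (Suc 0)" for j l
    proof (rule ccontr)
      assume "\<not> ?thesis"
      then have nz: "z j \<noteq> 0" "lookup (amat E 0 j l) 0 \<noteq> 0" by (auto simp: constant_terms_def)
      from constant_term_degrees[OF augmented_resolution_row[OF E j] nz(2)]
      have l: "l = 0" "ashift E (Suc 0) j = 0" by (auto simp: augmented_resolution_bottom[OF E])
      then have a0: "a = 0" using z(2)[OF nz(1)] False by simp
      have "first_entry (amat E 0 j 0) = boundary E 0 (unit_vector j)"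
        using augmented_resolution_row_free[OF E j]
        by (simp add: augmented_resolution_bottom[OF E] free_mod_one flip: row_is_boundary[OF E j])
      then have "amat E 0 j 0 \<in> J" using augmented_resolution_image[OF E] by (metis rangeI)
      then obtain f where f: "first_entry (amat E 0 j 0) = boundary C 0 f"
        using augmented_resolution_image[OF C, of "amat E 0 j 0"] by blast
      then have "amat E 0 j 0 = boundary C 0 f 0" by (metis first_entry_def)
      then have "lin (arank C (Suc 0)) (constant_terms (amat C 0)) (\<lambda>j. lookup (f j) 0) 0 \<noteq> 0"
        using nz(2) l(1) by (simp add: boundary_def constant_terms_lin)
      then obtain j' where j': "j' < arank C (Suc 0)" "lookup (amat C 0 j' 0) 0 \<noteq> 0"
        unfolding lin_def constant_terms_def by (metis (no_types, lifting) lessThan_iff mult_zero_right sum.neutral)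
      from constant_term_degrees[OF augmented_resolution_row[OF C j'(1)] j'(2)]
      have "ashift C (Suc 0) j' = a" by (simp add: augmented_resolution_bottom[OF C] a0)
      then show False using no j'(1) False by simp
    qed
    then show ?thesis using False by (simp add: lin_def del: mult_eq_0_iff)
  qed (use z(3) in simp)
  have "lin (arank ?H (Suc (Suc i))) (constant_terms (amat ?H (Suc i))) w = (\<lambda>_. 0)"
    unfolding w_def r_def bd \<phi>z Ez by (auto simp: join_def)
  then obtain y where y: "w = lin (arank ?H (Suc (Suc (Suc i)))) (constant_terms (amat ?H (Suc (Suc i)))) y"
    using unit_ideal_tensor_exact[OF H w] by blast
  define g where "g = (\<lambda>l. y (arank C (Suc (Suc (Suc i))) + l))"
  have zg: "z l = - lin (arank E (Suc (Suc i))) (constant_terms (amat E (Suc i))) g l" for l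
  proof -
    have "constant_terms (amat C (Suc (Suc i))) j (r + l) = 0" if "j < arank C (Suc (Suc (Suc i)))" for j
      using augmented_resolution_row_free[OF C that] by (simp add: free_mod_def constant_terms_def r_def)
    then have C0: "lin (arank C (Suc (Suc (Suc i)))) (constant_terms (amat C (Suc (Suc i)))) y (r + l) = 0"
      by (simp add: lin_def)
    have "z l = w (r + l)" by (simp add: w_def join_def)
    also have "\<dots> = lin (arank ?H (Suc (Suc (Suc i)))) (constant_terms (amat ?H (Suc (Suc i))))
        (join (arank C (Suc (Suc (Suc i)))) y g) (r + l)"
      unfolding g_def join_split y ..
    also have "\<dots> = - lin (arank E (Suc (Suc i))) (constant_terms (amat E (Suc i))) g l"
      unfolding bd C0 by (simp add: join_def r_def)
    finally show ?thesis .
  qed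
  \<comment> \<open>The part of the preimage of degree \<open>a\<close> suffices, since constant entries of a differential
    connect only basis elements of equal degree.\<close>
  define y' where "y' j = (if j < arank E (Suc (Suc i)) \<and> ashift E (Suc (Suc i)) j = a then - g j else 0)" for j
  have "z = lin (arank E (Suc (Suc i))) (constant_terms (amat E (Suc i))) y'"
  proof
    fix l
    show "z l = lin (arank E (Suc (Suc i))) (constant_terms (amat E (Suc i))) y' l"
    proof (cases "ashift E (Suc i) l = a")
      case True
      have "y' j * constant_terms (amat E (Suc i)) j l = - g j * constant_terms (amat E (Suc i)) j l"
        if j: "j < arank E (Suc (Suc i))" for j
        using constant_term_degrees[OF augmented_resolution_row[OF E j], of l] True j
        by (auto simp: y'_def constant_terms_def)
      then show ?thesis unfolding zg by (simp add: lin_def sum_negf)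
    next
      case False
      have "y' j * constant_terms (amat E (Suc i)) j l = 0"
        if j: "j < arank E (Suc (Suc i))" for j
        using constant_term_degrees[OF augmented_resolution_row[OF E j], of l] False j
        by (auto simp: y'_def constant_terms_def)
      then have "lin (arank E (Suc (Suc i))) (constant_terms (amat E (Suc i))) y' l = 0"
        by (simp add: lin_def del: mult_eq_0_iff)
      then show ?thesis using z(2) False by metis
    qed
  qed
  moreover have "y' \<in> free_mod (arank E (Suc (Suc i)))" by (simp add: y'_def free_mod_def)
  moreover have "\<forall>j. y' j \<noteq> 0 \<longrightarrow> ashift E (Suc (Suc i)) j = a" by (simp add: y'_def)
  ultimately show ?thesis by blast
qed

definition augment ::
    "('n exponent, ('n, 'k::field) mpoly) free_complex \<Rightarrow> ('n, ('n, 'k) mpoly) augmented_complex" where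
  "augment F = \<lparr>
     arank = (\<lambda>i. case i of 0 \<Rightarrow> 1 | Suc h \<Rightarrow> rank F h),
     ashift = (\<lambda>i. case i of 0 \<Rightarrow> (\<lambda>_. 0) | Suc h \<Rightarrow> shift F h),
     amat = (\<lambda>i. case i of 0 \<Rightarrow> (\<lambda>j. first_entry (aug F j))
       | Suc h \<Rightarrow> (\<lambda>j l. if l < rank F h then bd F h j l else 0))\<rparr>"

lemma augment_simps [simp]:
  "arank (augment F) 0 = 1" "arank (augment F) (Suc h) = rank F h"
  "ashift (augment F) 0 = (\<lambda>_. 0)" "ashift (augment F) (Suc h) = shift F h"
  "amat (augment F) 0 = (\<lambda>j. first_entry (aug F j))"
  "amat (augment F) (Suc h) = (\<lambda>j l. if l < rank F h then bd F h j l else 0)"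
  by (simp_all add: augment_def)

lemma boundary_augment_0: "boundary (augment F) 0 f = first_entry (augmentation F f)"
  by (auto simp: boundary_def lin_def augmentation_def first_entry_def)

lemma boundary_augment_Suc: "boundary (augment F) (Suc i) = differential F i"
  by (auto simp: boundary_def lin_def differential_def apply_matrix_def fun_eq_iff)

lemma augmented_resolution_augment:
  fixes F :: "('n exponent, ('n, 'k::field) mpoly) free_complex"
  assumes F: "graded_free_resolution (\<lambda>b. b) F J"
  shows "augmented_resolution (augment F) J"
  unfolding augmented_resolution_def
proof (intro conjI allI ballI impI)
  show "arank (augment F) 0 = 1" "ashift (augment F) 0 0 = 0" by simp_all
  fix i
  show "amat (augment F) i j \<in> homogeneous (arank (augment F) i) (ashift (augment F) i) (ashift (augment F) (Suc i) j)"
    if "j < arank (augment F) (Suc i)" for j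
  proof (cases i)
    case 0
    then show ?thesis using F that unfolding graded_free_resolution_def homogeneous_def
      by (simp add: first_entry_def free_mod_def)
  next
    case (Suc h)
    then show ?thesis using F that unfolding graded_free_resolution_def homogeneous_def
      by (simp add: free_mod_def)
  qed
  show "x \<in> J \<longleftrightarrow> first_entry x \<in> range (boundary (augment F) 0)" for x
  proof -
    have "range (boundary (augment F) 0) = boundary (augment F) 0 ` free_mod (rank F 0)"
      by (simp add: boundary_def range_lin)
    also have "\<dots> = first_entry ` J"
      using F unfolding graded_free_resolution_def boundary_augment_0 by (auto simp flip: image_image)
    finally show ?thesis by auto
  qed
  fix f :: "nat \<Rightarrow> ('n, 'k) mpoly"
  assume f: "f \<in> free_mod (arank (augment F) (Suc i))"
  have "range (boundary (augment F) (Suc i)) = differential F i ` free_mod (rank F (Suc i))"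
    unfolding boundary_augment_Suc[symmetric] by (simp add: boundary_def range_lin)
  also have "\<dots> = {f \<in> free_mod (rank F i). boundary (augment F) i f = (\<lambda>_. 0)}"
  proof (cases i)
    case 0
    have "first_entry x = (\<lambda>_. 0) \<longleftrightarrow> x = 0" for x :: "('n, 'k) mpoly"
      by (auto simp: first_entry_def fun_eq_iff)
    then show ?thesis using F 0 unfolding graded_free_resolution_def
      by (simp add: boundary_augment_0)
  next
    case (Suc h)
    then show ?thesis using F unfolding graded_free_resolution_def by (simp add: boundary_augment_Suc)
  qed
  finally show "boundary (augment F) i f = (\<lambda>_. 0) \<longleftrightarrow> f \<in> range (boundary (augment F) (Suc i))"
    using f by simp
qed

definition forget_augmentation ::
    "('n exponent \<Rightarrow> 'g) \<Rightarrow> ('n, ('n, 'k::field) mpoly) augmented_complex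
      \<Rightarrow> ('g, ('n, 'k) mpoly) free_complex" where
  "forget_augmentation wt C = \<lparr>rank = (\<lambda>i. arank C (Suc i)), shift = (\<lambda>i j. wt (ashift C (Suc i) j)),
     aug = (\<lambda>j. amat C 0 j 0), bd = (\<lambda>i. amat C (Suc i))\<rparr>"

text \<open>
  For \<open>wt\<close> the identity this is the multigraded resolution, for \<open>wt\<close> the total degree the
  graded one.
\<close>

lemma graded_free_resolution_forget:
  fixes C :: "('n, ('n, 'k::field) mpoly) augmented_complex"
  assumes C: "augmented_resolution C J" and wt: "\<And>a b. wt (a + b) = wt a + wt b"
  shows "graded_free_resolution wt (forget_augmentation wt C) J"
proof -
  let ?F = "forget_augmentation wt C"
  have sel: "rank ?F = (\<lambda>i. arank C (Suc i))" "shift ?F = (\<lambda>i j. wt (ashift C (Suc i) j))"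
    "aug ?F = (\<lambda>j. amat C 0 j 0)" "bd ?F = (\<lambda>i. amat C (Suc i))"
    by (simp_all add: forget_augmentation_def)
  have b0: "boundary C 0 f = first_entry (augmentation ?F f)" for f
  proof -
    have "boundary C 0 f = first_entry (boundary C 0 f 0)"
      using boundary_in_free_mod[OF C, of 0 f]
      unfolding augmented_resolution_bottom[OF C] free_mod_one .
    then show ?thesis by (simp add: boundary_def lin_def augmentation_def sel)
  qed
  have b: "boundary C (Suc i) f = differential ?F i f" for i f
  proof
    fix l
    show "boundary C (Suc i) f l = differential ?F i f l"
      using boundary_in_free_mod[OF C, of "Suc i" f]
      by (cases "l < arank C (Suc i)")
        (auto simp: sel differential_def apply_matrix_def free_mod_def, simp add: boundary_def lin_def)
  qed
  have img: "range (boundary C i) = boundary C i ` free_mod (arank C (Suc i))" for i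
    by (simp add: boundary_def range_lin)
  have fe0: "first_entry x = (\<lambda>_. 0) \<longleftrightarrow> x = 0" for x :: "('n, 'k) mpoly"
    by (auto simp: first_entry_def fun_eq_iff)
  show ?thesis
    unfolding graded_free_resolution_def
  proof (intro conjI allI impI ballI)
    fix j a assume j: "j < rank ?F 0" and a: "a \<in> keys (aug ?F j)"
    then show "wt a = shift ?F 0 j"
      using augmented_resolution_row[OF C, of j 0] augmented_resolution_bottom[OF C]
      unfolding sel homogeneous_def by (metis (mono_tags, lifting) add.right_neutral mem_Collect_eq)
  next
    fix i j l a assume j: "j < rank ?F (Suc i)" and "l < rank ?F i" and a: "a \<in> keys (bd ?F i j l)"
    have "a + ashift C (Suc i) l = ashift C (Suc (Suc i)) j"
      using augmented_resolution_row[OF C, of j "Suc i"] j a unfolding sel homogeneous_def by blast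
    then show "wt a + shift ?F i l = shift ?F (Suc i) j" unfolding sel by (metis wt)
  next
    have "x \<in> augmentation ?F ` free_mod (rank ?F 0) \<longleftrightarrow> first_entry x \<in> range (boundary C 0)" for x
      unfolding img b0 by (auto simp: sel)
    then show "augmentation ?F ` free_mod (rank ?F 0) = J"
      by (simp add: set_eq_iff augmented_resolution_image[OF C])
  next
    have "differential ?F 0 ` free_mod (rank ?F 1) = range (boundary C (Suc 0))"
      unfolding img b by (simp add: sel)
    also have "\<dots> = {f \<in> free_mod (rank ?F 0). boundary C 0 f = (\<lambda>_. 0)}"
      using augmented_resolution_exact[OF C, of _ 0] boundary_in_free_mod[OF C, of "Suc 0"]
      by (auto simp: sel)
    finally show "{f \<in> free_mod (rank ?F 0). augmentation ?F f = 0}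
        = differential ?F 0 ` free_mod (rank ?F 1)" unfolding b0 fe0 by simp
  next
    fix i
    have "differential ?F (Suc i) ` free_mod (rank ?F (Suc (Suc i))) = range (boundary C (Suc (Suc i)))"
      unfolding img b by (simp add: sel)
    also have "\<dots> = {f \<in> free_mod (rank ?F (Suc i)). boundary C (Suc i) f = (\<lambda>_. 0)}"
      using augmented_resolution_exact[OF C, of _ "Suc i"] boundary_in_free_mod[OF C, of "Suc (Suc i)"]
      by (auto simp: sel)
    finally show "{f \<in> free_mod (rank ?F (Suc i)). differential ?F i f = (\<lambda>_. 0)}
        = differential ?F (Suc i) ` free_mod (rank ?F (Suc (Suc i)))" unfolding b by simp
  qed
qed

text \<open>
  When the basis elements in consecutive positions never have equal degrees, all entries of
  the differentials have zero constant term, so that \<open>K \<otimes> C\<close> has zero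
  differential and each basis element is a nonzero class. That other resolutions give nothing
  more is \<open>tensor_cycle_is_boundary\<close>.
\<close>

lemma Tor_nonzero_iff:
  fixes C :: "('n, ('n, 'k::field) mpoly) augmented_complex"
  assumes C: "augmented_resolution C J"
    and minimal: "\<And>i j l. j < arank C (Suc (Suc i)) \<Longrightarrow> l < arank C (Suc i) \<Longrightarrow>
      ashift C (Suc (Suc i)) j \<noteq> ashift C (Suc i) l"
  shows "Tor_nonzero i J a \<longleftrightarrow> a \<in> ashift C (Suc i) ` {..<arank C (Suc i)}"
proof
  assume "Tor_nonzero i J a"
  then obtain F where F: "graded_free_resolution (\<lambda>b. b) F J"
    and nz: "\<not> tensor_cycles F i a \<subseteq> tensor_boundaries F i a"
    by (auto simp: Tor_nonzero_def)
  have td: "tensor_differential F h f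
      = lin (rank F (Suc h)) (constant_terms (amat (augment F) (Suc h))) f" for h f
    by (auto simp: tensor_differential_def apply_matrix_def lin_def constant_terms_def fun_eq_iff)
  show "a \<in> ashift C (Suc i) ` {..<arank C (Suc i)}"
  proof (rule ccontr)
    assume "\<not> ?thesis"
    then have no: "\<And>j. j < arank C (Suc i) \<Longrightarrow> ashift C (Suc i) j \<noteq> a" by blast
    have "z \<in> tensor_boundaries F i a" if z: "z \<in> tensor_cycles F i a" for z
    proof -
      have part: "z \<in> tensor_part F i a"
        using z by (auto simp: tensor_cycles_def split: nat.splits)
      have cyc: "i > 0 \<Longrightarrow> lin (rank F i) (constant_terms (amat (augment F) i)) z = (\<lambda>_. 0)"
        using z by (auto simp: tensor_cycles_def td split: nat.splits)
      obtain y where "y \<in> free_mod (rank F (Suc i))" "\<forall>j. y j \<noteq> 0 \<longrightarrow> shift F (Suc i) j = a"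
        "z = lin (rank F (Suc i)) (constant_terms (amat (augment F) (Suc i))) y"
        using tensor_cycle_is_boundary[OF C augmented_resolution_augment[OF F] no, of z] part cyc
        by (auto simp: tensor_part_def simp del: augment_simps(5,6))
      then show ?thesis
        by (auto simp: tensor_boundaries_def td tensor_part_def simp del: augment_simps(6))
    qed
    with nz show False by blast
  qed
next
  assume "a \<in> ashift C (Suc i) ` {..<arank C (Suc i)}"
  then obtain j where j: "j < arank C (Suc i)" "ashift C (Suc i) j = a" by auto
  let ?F = "forget_augmentation (\<lambda>b. b) C"
  have F: "graded_free_resolution (\<lambda>b. b) ?F J"
    by (rule graded_free_resolution_forget[OF C]) simp
  have sel: "rank ?F = (\<lambda>i. arank C (Suc i))" "shift ?F = (\<lambda>i. ashift C (Suc i))"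
    "bd ?F = (\<lambda>i. amat C (Suc i))"
    by (simp_all add: forget_augmentation_def)
  have "lookup (amat C (Suc h) j l) 0 = 0" if "j < arank C (Suc (Suc h))" "l < arank C (Suc h)" for h j l
    using constant_term_degrees[OF augmented_resolution_row[OF C that(1)], of l] minimal[OF that] by metis
  then have td: "tensor_differential ?F h f = (\<lambda>_. 0)" for h f
    by (auto simp: tensor_differential_def apply_matrix_def sel fun_eq_iff)
  have "unit_vector j \<in> tensor_cycles ?F i a"
    using j by (auto simp: tensor_cycles_def tensor_part_def td sel unit_vector_in_free_mod
        split: nat.split) (auto simp: unit_vector_def split: if_splits)
  moreover have "unit_vector j \<notin> tensor_boundaries ?F i a"
    by (auto simp: tensor_boundaries_def td) (metis unit_vector_def zero_neq_one)
  ultimately show "Tor_nonzero i J a"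
    using F unfolding Tor_nonzero_def by blast
qed

section \<open>Linear quotients\<close>

definition degrees :: "('n, 's) augmented_complex \<Rightarrow> nat \<Rightarrow> 'n exponent set" where
  "degrees C i = ashift C i ` {..<arank C i}"

lemma degrees_0: "augmented_resolution C J \<Longrightarrow> degrees C 0 = {0}"
  by (simp add: degrees_def augmented_resolution_bottom lessThan_Suc)

lemma resolution_zero_ideal:
  "\<exists>C. augmented_resolution C (monomial_ideal {} :: ('n, 'k::field) mpoly set) \<and>
    (\<forall>i. degrees C (Suc i) = {})"
proof -
  let ?C = "\<lparr>arank = (\<lambda>i. if i = 0 then 1 else 0), ashift = (\<lambda>_ _. 0), amat = (\<lambda>_ _ _. 0)\<rparr>
    :: ('n, ('n, 'k) mpoly) augmented_complex"
  have b: "boundary ?C i f = (\<lambda>_. 0)" for i f by (simp add: boundary_def lin_def)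
  have "monomial_ideal {} = ({0} :: ('n, 'k) mpoly set)"
    by (auto simp: monomial_ideal_def)
  moreover have "x = 0 \<longleftrightarrow> first_entry x \<in> range (boundary ?C 0)" for x
    by (auto simp: b first_entry_def fun_eq_iff)
  moreover have "boundary ?C i f = (\<lambda>_. 0) \<longleftrightarrow> f \<in> range (boundary ?C (Suc i))"
    if "f \<in> free_mod 0" for i f
    using that unfolding b by (auto simp: free_mod_def)
  ultimately have "augmented_resolution ?C (monomial_ideal {})"
    unfolding augmented_resolution_def by simp
  then show ?thesis by (intro exI[of _ ?C]) (simp add: degrees_def)
qed

lemma resolution_add_generator:
  fixes C E :: "('n, ('n, 'k::field) mpoly) augmented_complex"
  assumes C: "augmented_resolution C (monomial_ideal A)"
    and E: "augmented_resolution E (colon_monomial (monomial_ideal A) u)"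
  shows "\<exists>H. augmented_resolution H (monomial_ideal (insert u A) :: ('n, 'k) mpoly set) \<and>
    (\<forall>i. degrees H (Suc i) = degrees C (Suc i) \<union> (\<lambda>a. a + u) ` degrees E i)"
proof -
  obtain \<phi> where \<phi>: "comparison_map u E C \<phi>"
    using comparison_map_exists[OF C E] by blast
  have "join r f g ` {..<r + s} = f ` {..<r} \<union> g ` {..<s}" for r s and f g :: "nat \<Rightarrow> 'n exponent"
  proof -
    have "(\<lambda>l. r + l) ` {..<s} = {r..<r + s}"
      using image_add_atLeastLessThan[of r 0 s] by (simp add: lessThan_atLeast0 add.commute)
    then have "{..<r + s} = {..<r} \<union> (\<lambda>l. r + l) ` {..<s}" by auto
    then have "join r f g ` {..<r + s} = join r f g ` {..<r} \<union> (\<lambda>l. join r f g (r + l)) ` {..<s}"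
      by (simp only: image_Un image_image)
    also have "join r f g ` {..<r} = f ` {..<r}" by (rule image_cong) (auto simp: join_def)
    also have "(\<lambda>l. join r f g (r + l)) ` {..<s} = g ` {..<s}"
      by (rule image_cong) (auto simp: join_def)
    finally show ?thesis .
  qed
  then have "degrees (cone u E C \<phi>) (Suc i) = degrees C (Suc i) \<union> (\<lambda>a. a + u) ` degrees E i" for i
    by (simp add: degrees_def image_image)
  then show ?thesis
    using cone_resolution[OF C E \<phi>] unfolding monomial_ideal_insert by blast
qed

definition indicator_exponent :: "'n set \<Rightarrow> 'n exponent" where
  "indicator_exponent X = (\<Sum>t\<in>X. unit_exponent t)"

lemma lookup_indicator_exponent [simp]:
  fixes X :: "'n::finite set"
  shows "lookup (indicator_exponent X) t = (if t \<in> X then 1 else 0)"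
  by (simp add: indicator_exponent_def lookup_sum lookup_single when_def sum.delta)

text \<open>
  The degrees of the Koszul complex, obtained by adding one variable at a time: a variable
  \<open>x\<^sub>s\<close> is regular modulo the others, so the colon ideal is the ideal generated by the others,
  and the resolution found so far serves twice in the cone.
\<close>

lemma resolution_variables:
  fixes S :: "'n::finite set"
  shows "\<exists>E. augmented_resolution E (monomial_ideal (unit_exponent ` S) :: ('n, 'k::field) mpoly set) \<and>
    (\<forall>i. degrees E i = {indicator_exponent \<tau> | \<tau>. \<tau> \<subseteq> S \<and> card \<tau> = i})"
  using finite[of S]
proof (induction S rule: finite_induct)
  case empty
  obtain C where C: "augmented_resolution C (monomial_ideal {} :: ('n, 'k) mpoly set)"
    "\<And>i. degrees C (Suc i) = {}" using resolution_zero_ideal by blast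
  have "degrees C i = {indicator_exponent \<tau> | \<tau>. \<tau> \<subseteq> {} \<and> card \<tau> = i}" for i
    using C degrees_0[OF C(1)] by (cases i) (auto simp: indicator_exponent_def)
  then show ?case using C(1) by auto
next
  case (insert s S)
  then obtain E where E: "augmented_resolution E (monomial_ideal (unit_exponent ` S) :: ('n, 'k) mpoly set)"
    and degE: "\<And>i. degrees E i = {indicator_exponent \<tau> | \<tau>. \<tau> \<subseteq> S \<and> card \<tau> = i}" by blast
  have "colon_monomial (monomial_ideal (unit_exponent ` S)) (unit_exponent s)
      = (monomial_ideal (unit_exponent ` S) :: ('n, 'k) mpoly set)"
  proof (rule colon_monomial_ideal_variables)
    show "\<exists>a\<in>unit_exponent ` S. \<exists>b. unit_exponent s + unit_exponent t = a + b" if "t \<in> S" for t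
      using that by (metis add.commute imageI)
    show "\<exists>t\<in>S. lookup (unit_exponent s) t < lookup a t" if "a \<in> unit_exponent ` S" for a
      using that insert.hyps by (auto simp: lookup_single when_def)
  qed
  then obtain H where H: "augmented_resolution H (monomial_ideal (insert (unit_exponent s) (unit_exponent ` S)) :: ('n, 'k) mpoly set)"
    and degH: "\<And>i. degrees H (Suc i) = degrees E (Suc i) \<union> (\<lambda>a. a + unit_exponent s) ` degrees E i"
    using resolution_add_generator[of E "unit_exponent ` S" E "unit_exponent s"] E by auto
  have "degrees H i = {indicator_exponent \<tau> | \<tau>. \<tau> \<subseteq> insert s S \<and> card \<tau> = i}" for i
  proof (cases i)
    case 0
    then show ?thesis using degrees_0[OF H] by (auto simp: indicator_exponent_def)
  next
    case (Suc h)
    have ins: "indicator_exponent \<tau> + unit_exponent s = indicator_exponent (insert s \<tau>)"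
      "card (insert s \<tau>) = Suc (card \<tau>)" if "\<tau> \<subseteq> S" for \<tau>
    proof -
      have "finite \<tau>" "s \<notin> \<tau>" using that insert.hyps by auto
      then show "indicator_exponent \<tau> + unit_exponent s = indicator_exponent (insert s \<tau>)"
        "card (insert s \<tau>) = Suc (card \<tau>)"
        by (simp_all add: indicator_exponent_def add.commute)
    qed
    show ?thesis
    proof (intro equalityI subsetI)
      fix x assume "x \<in> degrees H i"
      then consider \<tau> where "\<tau> \<subseteq> S" "card \<tau> = i" "x = indicator_exponent \<tau>"
        | \<tau> where "\<tau> \<subseteq> S" "card \<tau> = h" "x = indicator_exponent \<tau> + unit_exponent s"
        unfolding Suc degH degE by blast
      then show "x \<in> {indicator_exponent \<tau> | \<tau>. \<tau> \<subseteq> insert s S \<and> card \<tau> = i}"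
      proof cases
        case 1 then show ?thesis by blast
      next
        case 2 then show ?thesis using ins[OF 2(1)] Suc by blast
      qed
    next
      fix x assume "x \<in> {indicator_exponent \<tau> | \<tau>. \<tau> \<subseteq> insert s S \<and> card \<tau> = i}"
      then obtain \<tau> where \<tau>: "\<tau> \<subseteq> insert s S" "card \<tau> = i" "x = indicator_exponent \<tau>" by blast
      show "x \<in> degrees H i"
      proof (cases "s \<in> \<tau>")
        case True
        define \<rho> where "\<rho> = \<tau> - {s}"
        have \<rho>: "\<rho> \<subseteq> S" "\<tau> = insert s \<rho>" using \<tau> True by (auto simp: \<rho>_def)
        then have "card \<rho> = h" "x = indicator_exponent \<rho> + unit_exponent s"
          using ins[OF \<rho>(1)] \<tau> Suc by auto
        then show ?thesis unfolding Suc degH degE using \<rho>(1) by blast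
      next
        case False
        then have "\<tau> \<subseteq> S" using \<tau> by blast
        then show ?thesis unfolding Suc degH degE using \<tau> Suc by blast
      qed
    qed
  qed
  then show ?case using H by auto
qed

text \<open>
  The generators are added in decreasing lexicographic order, which is the order \<open><\<close> on
  finitely supported maps.
\<close>

theorem resolution_linear_quotients:
  fixes G :: "'n::{finite,linorder} exponent set"
  assumes "finite G"
    and "\<And>w. w \<in> G \<Longrightarrow> colon_monomial (monomial_ideal {v \<in> G. w < v}) w
      = (monomial_ideal (unit_exponent ` S w) :: ('n, 'k::field) mpoly set)"
  shows "\<exists>C. augmented_resolution C (monomial_ideal G :: ('n, 'k) mpoly set) \<and>
    (\<forall>i. degrees C (Suc i) = {w + indicator_exponent \<tau> | w \<tau>. w \<in> G \<and> \<tau> \<subseteq> S w \<and> card \<tau> = i})"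
  using assms
proof (induction G rule: finite_linorder_min_induct)
  case empty
  then show ?case using resolution_zero_ideal by auto
next
  case (insert u A)
  have "{v \<in> insert u A. w < v} = {v \<in> A. w < v}" if "w \<in> A" for w
    using insert.hyps that by auto
  then have "colon_monomial (monomial_ideal {v \<in> A. w < v}) w
      = (monomial_ideal (unit_exponent ` S w) :: ('n, 'k) mpoly set)" if "w \<in> A" for w
    using insert.prems[of w] that by simp
  from insert.IH[OF this] obtain C
    where C: "augmented_resolution C (monomial_ideal A :: ('n, 'k) mpoly set)"
    and degC: "\<And>i. degrees C (Suc i) = {w + indicator_exponent \<tau> | w \<tau>. w \<in> A \<and> \<tau> \<subseteq> S w \<and> card \<tau> = i}"
    by auto
  obtain E where E: "augmented_resolution E (monomial_ideal (unit_exponent ` S u) :: ('n, 'k) mpoly set)"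
    and degE: "\<And>i. degrees E i = {indicator_exponent \<tau> | \<tau>. \<tau> \<subseteq> S u \<and> card \<tau> = i}"
    using resolution_variables by blast
  have "{v \<in> insert u A. u < v} = A" using insert.hyps by auto
  then have "colon_monomial (monomial_ideal A) u = (monomial_ideal (unit_exponent ` S u) :: ('n, 'k) mpoly set)"
    using insert.prems[of u] by simp
  then obtain H where H: "augmented_resolution H (monomial_ideal (insert u A) :: ('n, 'k) mpoly set)"
    and degH: "\<And>i. degrees H (Suc i) = degrees C (Suc i) \<union> (\<lambda>a. a + u) ` degrees E i"
    using resolution_add_generator[of C A E u] C E by auto
  have "degrees H (Suc i) = {w + indicator_exponent \<tau> | w \<tau>. w \<in> insert u A \<and> \<tau> \<subseteq> S w \<and> card \<tau> = i}" for i
  proof -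
    have "(\<lambda>a. a + u) ` degrees E i = {u + indicator_exponent \<tau> | \<tau>. \<tau> \<subseteq> S u \<and> card \<tau> = i}"
      unfolding degE by (auto simp: add.commute)
    then show ?thesis unfolding degH degC by blast
  qed
  then show ?case using H by auto
qed

section \<open>The lexicographic exchange property\<close>

definition exchange_variables :: "'n::linorder exponent set \<Rightarrow> 'n exponent \<Rightarrow> 'n set" where
  "exchange_variables G w = {i. \<exists>j>i. 0 < lookup w j \<and> w + unit_exponent i - unit_exponent j \<in> G}"

text \<open>
  A one-sided form of the exchange property of polymatroids: weight is moved only to the first
  place where \<open>w\<close> falls short of \<open>v\<close>, and only from later places.
\<close>

definition lex_exchange :: "'n::linorder exponent set \<Rightarrow> bool" where
  "lex_exchange G \<longleftrightarrow> (\<forall>v\<in>G. \<forall>w\<in>G. \<forall>i. lookup w i < lookup v i \<longrightarrow> (\<forall>l<i. lookup w l = lookup v l)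
     \<longrightarrow> i \<in> exchange_variables G w)"

lemma total_degree_add: "total_degree (a + b) = total_degree a + total_degree b"
  by (simp add: total_degree_def lookup_add sum.distrib)

lemma total_degree_indicator [simp]: "total_degree (indicator_exponent X) = card X"
  by (simp add: total_degree_def sum.If_cases)

lemma less_exponent_iff:
  "(w :: 'n::linorder exponent) < v \<longleftrightarrow> (\<exists>i. lookup w i < lookup v i \<and> (\<forall>l<i. lookup w l = lookup v l))"
  by (simp add: less_poly_mapping.rep_eq less_fun_def)

text \<open>
  \<open>x\<^sub>t w / x\<^sub>j\<close> with \<open>j > t\<close> is lexicographically larger than \<open>w\<close>, so exchange variables lie
  in the colon ideal of the earlier generators. The exchange property provides, for each
  earlier generator \<open>a\<close>, an exchange variable that divides \<open>a / gcd(a, w)\<close>.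
\<close>

lemma lex_exchange_resolution:
  fixes G :: "'n::{finite,linorder} exponent set"
  assumes G: "finite G" "lex_exchange G"
  shows "\<exists>C. augmented_resolution C (monomial_ideal G :: ('n, 'k::field) mpoly set) \<and>
    (\<forall>i. degrees C (Suc i)
      = {w + indicator_exponent \<tau> | w \<tau>. w \<in> G \<and> \<tau> \<subseteq> exchange_variables G w \<and> card \<tau> = i})"
proof (rule resolution_linear_quotients[OF G(1)], rule colon_monomial_ideal_variables)
  fix w t assume w: "w \<in> G" and "t \<in> exchange_variables G w"
  then obtain j where j: "t < j" "0 < lookup w j" "w + unit_exponent t - unit_exponent j \<in> G"
    by (auto simp: exchange_variables_def)
  have "w < w + unit_exponent t - unit_exponent j"
    unfolding less_exponent_iff using j
    by (intro exI[of _ t]) (auto simp: lookup_add lookup_minus lookup_single when_def)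
  moreover have "w + unit_exponent t = (w + unit_exponent t - unit_exponent j) + unit_exponent j"
    using j by (intro poly_mapping_eqI) (auto simp: lookup_add lookup_minus lookup_single when_def)
  ultimately show "\<exists>a\<in>{v \<in> G. w < v}. \<exists>b. w + unit_exponent t = a + b"
    using j by blast
next
  fix w a assume "w \<in> G" "a \<in> {v \<in> G. w < v}"
  then show "\<exists>t\<in>exchange_variables G w. lookup w t < lookup a t"
    using G(2) unfolding lex_exchange_def less_exponent_iff by blast
qed

theorem lex_exchange_Tor:
  fixes G :: "'n::{finite,linorder} exponent set"
  assumes G: "finite G" "lex_exchange G" and d: "\<And>w. w \<in> G \<Longrightarrow> total_degree w = d"
  shows "Tor_nonzero i (monomial_ideal G :: ('n, 'k::field) mpoly set) a \<longleftrightarrow>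
    (\<exists>w\<in>G. \<exists>\<tau>\<subseteq>exchange_variables G w. card \<tau> = i \<and> a = w + indicator_exponent \<tau>)"
proof -
  obtain C where C: "augmented_resolution C (monomial_ideal G :: ('n, 'k) mpoly set)"
    and deg: "\<And>i. degrees C (Suc i)
      = {w + indicator_exponent \<tau> | w \<tau>. w \<in> G \<and> \<tau> \<subseteq> exchange_variables G w \<and> card \<tau> = i}"
    using lex_exchange_resolution[OF G] by blast
  have td: "total_degree (ashift C (Suc i) j) = d + i" if "j < arank C (Suc i)" for i j
  proof -
    have "ashift C (Suc i) j \<in> degrees C (Suc i)" using that by (simp add: degrees_def)
    then show ?thesis unfolding deg by (auto simp: total_degree_add d)
  qed
  have "Tor_nonzero i (monomial_ideal G :: ('n, 'k) mpoly set) a \<longleftrightarrow> a \<in> degrees C (Suc i)"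
    unfolding degrees_def
  proof (rule Tor_nonzero_iff[OF C])
    fix i j l assume "j < arank C (Suc (Suc i))" "l < arank C (Suc i)"
    then show "ashift C (Suc (Suc i)) j \<noteq> ashift C (Suc i) l"
      using td by (metis add_left_cancel n_not_Suc_n)
  qed
  then show ?thesis unfolding deg by blast
qed

theorem lex_exchange_linear_resolution:
  fixes G :: "'n::{finite,linorder} exponent set"
  assumes G: "finite G" "lex_exchange G" and d: "\<And>w. w \<in> G \<Longrightarrow> total_degree w = d"
  shows "has_linear_resolution (monomial_ideal G :: ('n, 'k::field) mpoly set)"
proof -
  obtain C where C: "augmented_resolution C (monomial_ideal G :: ('n, 'k) mpoly set)"
    and deg: "\<And>i. degrees C (Suc i)
      = {w + indicator_exponent \<tau> | w \<tau>. w \<in> G \<and> \<tau> \<subseteq> exchange_variables G w \<and> card \<tau> = i}"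
    using lex_exchange_resolution[OF G] by blast
  let ?F = "forget_augmentation total_degree C"
  have "shift ?F i j = d + i" if "j < rank ?F i" for i j
  proof -
    have "ashift C (Suc i) j \<in> degrees C (Suc i)"
      using that by (simp add: degrees_def forget_augmentation_def)
    then show ?thesis unfolding deg by (auto simp: forget_augmentation_def total_degree_add d)
  qed
  then show ?thesis
    unfolding has_linear_resolution_def
    using graded_free_resolution_forget[OF C total_degree_add] by blast
qed

section \<open>The generators of the powers\<close>

definition weight :: "'n set \<Rightarrow> 'n exponent \<Rightarrow> nat" where
  "weight X u = (\<Sum>t\<in>X. lookup u t)"

abbreviation swap :: "'n exponent \<Rightarrow> 'n \<Rightarrow> 'n \<Rightarrow> 'n exponent" where
  "swap u i j \<equiv> u + unit_exponent i - unit_exponent j"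

lemma weight_add: "weight X (a + b) = weight X a + weight X b"
  by (simp add: weight_def lookup_add sum.distrib)

lemma weight_unit: "weight X (unit_exponent t) = (if t \<in> X then 1 else 0)" for X :: "'n::finite set"
  by (simp add: weight_def lookup_single when_def sum.delta')

lemma weight_indicator: "weight X (indicator_exponent Y) = card (X \<inter> Y)" for X :: "'n::finite set"
  by (simp add: weight_def sum.If_cases)

lemma weight_UNIV: "weight UNIV u = total_degree u"
  by (simp add: weight_def total_degree_def)

lemma weight_mono: "X \<subseteq> Y \<Longrightarrow> weight X u \<le> weight Y u" for X :: "'n::finite set"
  unfolding weight_def by (rule sum_mono2) auto

lemma weight_Un_disjoint: "X \<inter> Y = {} \<Longrightarrow> weight (X \<union> Y) u = weight X u + weight Y u"
  for X :: "'n::finite set"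
  unfolding weight_def by (rule sum.union_disjoint) auto

lemma weight_insert: "t \<notin> X \<Longrightarrow> weight (insert t X) u = lookup u t + weight X u" for X :: "'n::finite set"
  by (simp add: weight_def)

lemma lookup_le_weight: "t \<in> X \<Longrightarrow> lookup u t \<le> weight X u" for X :: "'n::finite set"
  unfolding weight_def by (rule member_le_sum) auto

lemma two_lookups_le_weight: "s \<in> X \<Longrightarrow> t \<in> X \<Longrightarrow> s \<noteq> t \<Longrightarrow> lookup u s + lookup u t \<le> weight X u"
  for X :: "'n::finite set"
  using weight_mono[of "{s, t}" X u] by (simp add: weight_def)

lemma three_lookups_le_weight:
  "r \<in> X \<Longrightarrow> s \<in> X \<Longrightarrow> t \<in> X \<Longrightarrow> r \<noteq> s \<Longrightarrow> r \<noteq> t \<Longrightarrow> s \<noteq> t \<Longrightarrow>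
    lookup u r + lookup u s + lookup u t \<le> weight X u" for X :: "'n::finite set"
  using weight_mono[of "{r, s, t}" X u] by (simp add: weight_def)

lemma weight_pos_iff: "0 < weight X u \<longleftrightarrow> (\<exists>t\<in>X. 0 < lookup u t)" for X :: "'n::finite set"
  unfolding weight_def neq0_conv[symmetric] by auto

lemma lookup_swap:
  "i \<noteq> j \<Longrightarrow> lookup (swap u i j) t
    = (if t = i then lookup u i + 1 else if t = j then lookup u j - 1 else lookup u t)"
  by (auto simp: lookup_add lookup_minus lookup_single when_def)

lemma swap_plus: "i \<noteq> j \<Longrightarrow> 0 < lookup u j \<Longrightarrow> swap u i j + unit_exponent j = u + unit_exponent i"
  by (intro poly_mapping_eqI) (auto simp: lookup_add lookup_minus lookup_single when_def)

lemma weight_swap: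
  fixes u :: "'n::finite exponent"
  assumes "i \<noteq> j" "0 < lookup u j"
  shows "weight X (swap u i j) + (if j \<in> X then 1 else 0) = weight X u + (if i \<in> X then 1 else 0)"
  using arg_cong[OF swap_plus[OF assms], of "weight X"] by (simp only: weight_add weight_unit)

text \<open>
  The exponents that satisfy the inequalities of the independent sets of the graph, which are
  single vertices, \<open>{p<..}\<close> and \<open>{p} \<union> {q<..}\<close>, and their subsets.
\<close>

definition power_exponents :: "'n::{finite,linorder} \<Rightarrow> 'n \<Rightarrow> nat \<Rightarrow> 'n exponent set" where
  "power_exponents p q k = {u. weight UNIV u = 2 * k \<and> (\<forall>t. lookup u t \<le> k) \<and>
     weight {p<..} u \<le> k \<and> weight (insert p {q<..}) u \<le> k}"

lemma finite_power_exponents: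
  fixes p q :: "'n::{finite,linorder}"
  shows "finite (power_exponents p q k)"
proof -
  have "lookup ` power_exponents p q k \<subseteq> {f. \<forall>t. f t \<in> {..k}}"
    by (auto simp: power_exponents_def)
  moreover have "finite {f :: 'n \<Rightarrow> nat. \<forall>t. f t \<in> {..k}}"
    using finite_set_of_finite_funs[of "UNIV :: 'n set" "{..k}" 0] by simp
  ultimately have "finite (lookup ` power_exponents p q k)" by (rule finite_subset)
  moreover have "inj_on lookup (power_exponents p q k)" by (rule inj_onI) (simp add: lookup_inject)
  ultimately show ?thesis using finite_image_iff[of lookup "power_exponents p q k"] by simp
qed

lemma power_exponents_0: "power_exponents p q 0 = {0}"
  by (auto simp: power_exponents_def weight_def intro!: poly_mapping_eqI)

text \<open>
  A squarefree exponent \<open>x\<^sub>i x\<^sub>j\<close> with \<open>i < j\<close> violates the first weight bound if \<open>i > p\<close>, and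
  the second if \<open>i = p\<close> and \<open>j > q\<close>; these are the pairs lexicographically below
  \<open>x\<^sub>p x\<^sub>q\<close>.
\<close>

lemma edge_exponents:
  fixes p q :: "'n::{finite,linorder}"
  assumes pq: "p < q"
  shows "{w. squarefree_exponent w \<and> total_degree w = 2 \<and> lex_ge w (unit_exponent p + unit_exponent q)}
    = power_exponents p q 1"
proof (intro equalityI subsetI)
  let ?v = "unit_exponent p + unit_exponent q"
  have v: "lookup ?v t = (if t = p \<or> t = q then 1 else 0)" for t
    using pq by (auto simp: lookup_add lookup_single when_def)
  fix w assume "w \<in> {w. squarefree_exponent w \<and> total_degree w = 2 \<and> lex_ge w ?v}"
  then have sf: "\<And>t. lookup w t \<le> 1" and deg: "weight UNIV w = 2" and ge: "lex_ge w ?v"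
    by (auto simp: squarefree_exponent_def weight_UNIV)
  have outside: "weight X w \<le> 1" if "t \<notin> X" "lookup w t = 1" for t X
    using weight_mono[of "insert t X" UNIV w] weight_insert[of t X w] that deg by simp
  have "weight {p<..} w \<le> 1 \<and> weight (insert p {q<..}) w \<le> 1"
  proof (cases "w = ?v")
    case True
    then show ?thesis using outside[of p "{p<..}"] outside[of q "insert p {q<..}"] pq v by auto
  next
    case False
    then obtain i where i: "lookup ?v i < lookup w i" "\<And>l. l < i \<Longrightarrow> lookup w l = lookup ?v l"
      using ge by (auto simp: lex_ge_def)
    have wi: "lookup w i = 1" "i \<noteq> p" "i \<noteq> q" using i(1) sf[of i] v[of i] by (auto split: if_splits)
    show ?thesis
    proof (cases "i < p")
      case True
      then show ?thesis using outside[of i] wi pq by auto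
    next
      case False
      then have "p < i" using wi by auto
      then have wp: "lookup w p = 1" using i(2)[of p] v by auto
      have "i < q"
      proof (rule ccontr)
        assume "\<not> i < q"
        then have "q < i" using wi by auto
        then have "lookup w q = 1" using i(2)[of q] v by auto
        then show False using three_lookups_le_weight[of p UNIV q i w] deg wp wi pq by auto
      qed
      then show ?thesis
        using outside[of p "{p<..}"] outside[of i "insert p {q<..}"] wp wi by auto
    qed
  qed
  then show "w \<in> power_exponents p q 1" using sf deg by (simp add: power_exponents_def)
next
  let ?v = "unit_exponent p + unit_exponent q"
  have v: "lookup ?v t = (if t = p \<or> t = q then 1 else 0)" for t
    using pq by (auto simp: lookup_add lookup_single when_def)
  fix w assume "w \<in> power_exponents p q 1"
  then have deg: "weight UNIV w = 2" and sf: "\<And>t. lookup w t \<le> 1" and T: "weight {p<..} w \<le> 1"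
    and B: "weight (insert p {q<..}) w \<le> 1" by (auto simp: power_exponents_def)
  have "lex_ge w ?v"
  proof (cases "\<exists>t<p. 0 < lookup w t")
    case True
    define t where "t = Min {t. t < p \<and> 0 < lookup w t}"
    have t: "t < p" "0 < lookup w t"
      using Min_in[of "{t. t < p \<and> 0 < lookup w t}"] True by (auto simp: t_def)
    have "lookup w l = 0" if "l < t" for l
      using Min_le[of "{t. t < p \<and> 0 < lookup w t}" l] that t(1) unfolding t_def[symmetric]
      by (metis (mono_tags, lifting) dual_order.strict_trans finite_code gr0I leD mem_Collect_eq)
    then show ?thesis unfolding lex_ge_def using t v pq by (intro disjI2 exI[of _ t]) auto
  next
    case False
    then have low: "lookup w t = 0" if "t < p" for t using that by auto
    have "weight UNIV w = weight {..<p} w + weight (insert p {p<..}) w"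
      by (subst weight_Un_disjoint[symmetric]) (auto intro!: arg_cong2[of _ _ _ _ weight])
    moreover have "weight {..<p} w = 0" using low by (simp add: weight_def)
    ultimately have wp: "lookup w p = 1" and wT: "weight {p<..} w = 1"
      using deg sf[of p] T by (auto simp: weight_insert)
    then obtain j where j: "p < j" "0 < lookup w j"
      using weight_pos_iff[of "{p<..}" w] by auto
    have wj: "lookup w j = 1" using sf[of j] j by linarith
    have jq: "j \<le> q"
      using two_lookups_le_weight[of p "insert p {q<..}" j w] B wp wj j by fastforce
    have other: "lookup w t = 0" if "p < t" "t \<noteq> j" for t
      using two_lookups_le_weight[of t "{p<..}" j w] wT wj j that by simp
    have wt: "lookup w t = (if t = p \<or> t = j then 1 else 0)" for t
      using wp wj other[of t] low[of t] by (metis linorder_neqE)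
    show ?thesis
    proof (cases "j = q")
      case True
      then have "w = ?v" using wt v by (intro poly_mapping_eqI) simp
      then show ?thesis by (simp add: lex_ge_def)
    next
      case False
      then show ?thesis unfolding lex_ge_def using wt v j jq
        by (intro disjI2 exI[of _ j]) auto
    qed
  qed
  then show "w \<in> {w. squarefree_exponent w \<and> total_degree w = 2 \<and> lex_ge w ?v}"
    using sf deg by (simp add: squarefree_exponent_def weight_UNIV)
qed

text \<open>
  The last three conditions say that the edge \<open>{i, j}\<close> meets every set whose inequality is
  sharp for \<open>u\<close>, so that removing it leaves an element for \<open>k\<close>. If some variable before
  \<open>p\<close> occurs, \<open>i\<close> is chosen there with the largest exponent, and \<open>j\<close> in whichever of the
  two independent sets are sharp; when both are, comparing the weights shows that their
  intersection \<open>{q<..}\<close> meets the support. If no variable before \<open>p\<close> occurs, then \<open>x\<^sub>p\<close> must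
  have exponent \<open>k + 1\<close> and the rest of the support lies strictly after \<open>p\<close>, up to \<open>q\<close>.
\<close>

lemma obtain_edge:
  fixes p q :: "'n::{finite,linorder}"
  assumes pq: "p < q" and u: "u \<in> power_exponents p q (Suc k)"
  obtains i j where "i \<noteq> j" "0 < lookup u i" "0 < lookup u j"
    "\<not> (i \<in> {p<..} \<and> j \<in> {p<..})" "\<not> (i \<in> insert p {q<..} \<and> j \<in> insert p {q<..})"
    "weight {p<..} u = Suc k \<Longrightarrow> i \<in> {p<..} \<or> j \<in> {p<..}"
    "weight (insert p {q<..}) u = Suc k \<Longrightarrow> i \<in> insert p {q<..} \<or> j \<in> insert p {q<..}"
    "\<And>t. lookup u t = Suc k \<Longrightarrow> t = i \<or> t = j"
proof -
  have deg: "weight UNIV u = 2 * Suc k" and le: "\<And>t. lookup u t \<le> Suc k" and T: "weight {p<..} u \<le> Suc k"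
    and B: "weight (insert p {q<..}) u \<le> Suc k" using u by (auto simp: power_exponents_def)
  have split: "weight UNIV u = weight {..<p} u + (lookup u p + weight {p<..} u)"
  proof -
    have "UNIV = {..<p} \<union> insert p {p<..}" "{..<p} \<inter> insert p {p<..} = {}" by auto
    then have "weight UNIV u = weight {..<p} u + weight (insert p {p<..}) u"
      by (metis weight_Un_disjoint)
    then show ?thesis by (simp add: weight_insert)
  qed
  have B_eq: "weight (insert p {q<..}) u = lookup u p + weight {q<..} u"
    using pq by (intro weight_insert) simp
  show ?thesis
  proof (cases "\<exists>t<p. 0 < lookup u t")
    case True
    have "Max (lookup u ` {..<p}) \<in> lookup u ` {..<p}"
      using True by (intro Max_in) auto
    then obtain i where "i \<in> {..<p}" and i: "lookup u i = Max (lookup u ` {..<p})" by auto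
    have imax: "lookup u t \<le> lookup u i" if "t < p" for t
      unfolding i using that by (intro Max_ge) auto
    from \<open>i \<in> {..<p}\<close> have ip: "i < p" by simp
    have ui: "0 < lookup u i" using True imax by (auto intro: less_le_trans)
    have "\<exists>j. j \<noteq> i \<and> 0 < lookup u j \<and> (weight {p<..} u = Suc k \<longrightarrow> j \<in> {p<..}) \<and>
      (weight (insert p {q<..}) u = Suc k \<longrightarrow> j \<in> insert p {q<..})"
    proof (cases "weight {p<..} u = Suc k"; cases "weight (insert p {q<..}) u = Suc k")
      assume tight: "weight {p<..} u = Suc k" "weight (insert p {q<..}) u = Suc k"
      have "0 < weight {..<p} u" using ui ip weight_pos_iff[of "{..<p}" u] by auto
      then have "0 < weight {q<..} u" using tight split deg B_eq by simp
      then obtain j where "q < j" "0 < lookup u j" using weight_pos_iff[of "{q<..}" u] by auto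
      then show ?thesis using ip pq by (intro exI[of _ j]) auto
    next
      assume tight: "weight {p<..} u = Suc k" "weight (insert p {q<..}) u \<noteq> Suc k"
      then obtain j where "j \<in> {p<..}" "0 < lookup u j" using weight_pos_iff[of "{p<..}" u] by auto
      then show ?thesis using ip tight by (intro exI[of _ j]) auto
    next
      assume tight: "weight {p<..} u \<noteq> Suc k" "weight (insert p {q<..}) u = Suc k"
      then obtain j where "j \<in> insert p {q<..}" "0 < lookup u j"
        using weight_pos_iff[of "insert p {q<..}" u] by auto
      then show ?thesis using ip pq tight by (intro exI[of _ j]) auto
    next
      assume tight: "weight {p<..} u \<noteq> Suc k" "weight (insert p {q<..}) u \<noteq> Suc k"
      have "weight UNIV u = lookup u i + weight (UNIV - {i}) u"
        using weight_insert[of i "UNIV - {i}" u] by (simp add: insert_absorb)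
      then have "0 < weight (UNIV - {i}) u" using deg le[of i] by simp
      then obtain j where "j \<noteq> i" "0 < lookup u j" using weight_pos_iff[of "UNIV - {i}" u] by auto
      then show ?thesis using tight by blast
    qed
    then obtain j where j: "j \<noteq> i" "0 < lookup u j" "weight {p<..} u = Suc k \<Longrightarrow> j \<in> {p<..}"
      "weight (insert p {q<..}) u = Suc k \<Longrightarrow> j \<in> insert p {q<..}" by blast
    have singles: "t = i \<or> t = j" if t: "lookup u t = Suc k" for t
    proof (rule ccontr)
      assume nt: "\<not> ?thesis"
      consider "t < p" | "t = p" | "p < t" by fastforce
      then show False
      proof cases
        case 1
        then show False
          using imax[of t] three_lookups_le_weight[of t UNIV i j u] nt t ui j deg by auto
      next
        case 2
        have "weight (insert p {q<..}) u = Suc k" using B B_eq t 2 by simp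
        from j(4)[OF this] show False
          using two_lookups_le_weight[of t "insert p {q<..}" j u] nt t j 2 B by auto
      next
        case 3
        have "weight {p<..} u = Suc k" using T lookup_le_weight[of t "{p<..}" u] t 3 by simp
        from j(3)[OF this] show False
          using two_lookups_le_weight[of t "{p<..}" j u] nt t j 3 T by auto
      qed
    qed
    show ?thesis
      by (rule that[of i j]) (use ip pq ui j singles in auto)
  next
    case False
    then have "weight {..<p} u = 0" by (auto simp: weight_def)
    then have up: "lookup u p = Suc k" and uT: "weight {p<..} u = Suc k" and "weight {q<..} u = 0"
      using split deg le[of p] T B B_eq by auto
    obtain j where j: "p < j" "0 < lookup u j" using uT weight_pos_iff[of "{p<..}" u] by auto
    have jq: "\<not> q < j" using \<open>weight {q<..} u = 0\<close> weight_pos_iff[of "{q<..}" u] j by auto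
    have singles: "t = p \<or> t = j" if t: "lookup u t = Suc k" for t
    proof (rule ccontr)
      assume nt: "\<not> ?thesis"
      then have "p < t" using False t by (metis linorder_neqE zero_less_Suc)
      then show False using two_lookups_le_weight[of t "{p<..}" j u] nt t j T by auto
    qed
    show ?thesis
      by (rule that[of p j]) (use j jq up singles in auto)
  qed
qed

lemma power_exponents_Suc:
  fixes p q :: "'n::{finite,linorder}"
  assumes pq: "p < q"
  shows "{a + b | a b. a \<in> power_exponents p q 1 \<and> b \<in> power_exponents p q k} = power_exponents p q (Suc k)"
proof (intro equalityI subsetI)
  fix u assume "u \<in> {a + b | a b. a \<in> power_exponents p q 1 \<and> b \<in> power_exponents p q k}"
  then obtain a b where u: "u = a + b" and a: "a \<in> power_exponents p q 1"
    and b: "b \<in> power_exponents p q k" by blast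
  have "lookup u t \<le> Suc k" for t
  proof -
    have "lookup a t \<le> 1" "lookup b t \<le> k" using a b by (auto simp: power_exponents_def)
    then show ?thesis by (simp add: u lookup_add)
  qed
  then show "u \<in> power_exponents p q (Suc k)"
    using a b unfolding power_exponents_def by (auto simp: u weight_add)
next
  fix u assume u: "u \<in> power_exponents p q (Suc k)"
  obtain i j where ij: "i \<noteq> j" "0 < lookup u i" "0 < lookup u j"
    "\<not> (i \<in> {p<..} \<and> j \<in> {p<..})" "\<not> (i \<in> insert p {q<..} \<and> j \<in> insert p {q<..})"
    "weight {p<..} u = Suc k \<Longrightarrow> i \<in> {p<..} \<or> j \<in> {p<..}"
    "weight (insert p {q<..}) u = Suc k \<Longrightarrow> i \<in> insert p {q<..} \<or> j \<in> insert p {q<..}"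
    "\<And>t. lookup u t = Suc k \<Longrightarrow> t = i \<or> t = j"
    using obtain_edge[OF pq u] by blast
  define a where "a = unit_exponent i + unit_exponent j"
  define b where "b = u - a"
  have la: "lookup a t = (if t = i \<or> t = j then 1 else 0)" for t
    using ij(1) by (auto simp: a_def lookup_add lookup_single when_def)
  have uab: "u = a + b"
    using ij by (intro poly_mapping_eqI) (auto simp: b_def lookup_add lookup_minus la)
  have wa: "weight X a = (if i \<in> X then 1 else 0) + (if j \<in> X then 1 else 0)" for X
    unfolding a_def weight_add weight_unit ..
  have "a \<in> power_exponents p q 1"
    using ij(4,5) unfolding power_exponents_def by (auto simp: wa la)
  moreover have "b \<in> power_exponents p q k"
  proof -
    have wb: "weight X b \<le> k" if "weight X u \<le> Suc k" "weight X u = Suc k \<Longrightarrow> i \<in> X \<or> j \<in> X" for X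
      using that arg_cong[OF uab, of "weight X"] unfolding weight_add wa
      by (cases "weight X u = Suc k") (auto split: if_splits)
    have "lookup b t \<le> k" for t
    proof (cases "lookup u t = Suc k")
      case True
      then show ?thesis using ij(8)[of t] by (auto simp: b_def lookup_minus la)
    next
      case False
      moreover have "lookup u t \<le> Suc k" using u by (simp add: power_exponents_def)
      ultimately show ?thesis by (simp add: b_def lookup_minus)
    qed
    moreover have "weight UNIV b = 2 * k"
      using u arg_cong[OF uab, of "weight UNIV"] unfolding weight_add wa by (simp add: power_exponents_def)
    ultimately show ?thesis
      using u ij(6,7) wb[of "{p<..}"] wb[of "insert p {q<..}"] unfolding power_exponents_def by simp
  qed
  ultimately show "u \<in> {a + b | a b. a \<in> power_exponents p q 1 \<and> b \<in> power_exponents p q k}"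
    using uab by blast
qed

section \<open>Exchange for the powers and their homological shifts\<close>

text \<open>
  The exchange variables of a generator \<open>u\<close> of \<open>I\<^sup>k\<close>
  (\<open>exchange_variables_power_exponents\<close>).
\<close>

definition raisable :: "nat \<Rightarrow> 'n::linorder exponent \<Rightarrow> 'n set" where
  "raisable k u = {i. lookup u i < k \<and> (\<exists>j>i. 0 < lookup u j)}"

text \<open>
  The generators of \<open>HS\<^sub>r(I\<^sup>k)\<close> (\<open>homological_shift_ideal_power\<close>).
\<close>

definition shift_exponents :: "'n::{finite,linorder} \<Rightarrow> 'n \<Rightarrow> nat \<Rightarrow> nat \<Rightarrow> 'n exponent set" where
  "shift_exponents p q k r = {u + indicator_exponent \<sigma> | u \<sigma>.
     u \<in> power_exponents p q k \<and> \<sigma> \<subseteq> raisable k u \<and> card \<sigma> = r}"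

lemma swap_in_power_exponents:
  assumes u: "u \<in> power_exponents p q k" and ij: "i \<noteq> j" "lookup u i < k" "0 < lookup u j"
    and T: "p < i \<Longrightarrow> p < j \<or> weight {p<..} u < k"
    and B: "i \<in> insert p {q<..} \<Longrightarrow> j \<in> insert p {q<..} \<or> weight (insert p {q<..}) u < k"
  shows "swap u i j \<in> power_exponents p q k"
proof -
  have "lookup u t \<le> k" for t using u by (simp add: power_exponents_def)
  then have "lookup (swap u i j) t \<le> k" for t
    using ij(2) unfolding lookup_swap[OF ij(1)] by (auto intro: le_trans[OF diff_le_self])
  moreover have "weight UNIV (swap u i j) = 2 * k"
    using u weight_swap[OF ij(1,3), of UNIV] by (simp add: power_exponents_def)
  moreover have "weight {p<..} (swap u i j) \<le> k"
    using u T weight_swap[OF ij(1,3), of "{p<..}"] by (auto simp: power_exponents_def split: if_splits)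
  moreover have "weight (insert p {q<..}) (swap u i j) \<le> k"
    using u B weight_swap[OF ij(1,3), of "insert p {q<..}"]
    by (simp add: power_exponents_def split: if_splits)
  ultimately show ?thesis by (simp add: power_exponents_def)
qed

lemma swap_right_in_power_exponents:
  fixes p q :: "'n::{finite,linorder}"
  assumes pq: "p < q" and u: "u \<in> power_exponents p q k"
    and ij: "i < j" "lookup u i < k" "0 < lookup u j"
    and p: "i = p \<Longrightarrow> q < j \<or> weight (insert p {q<..}) u < k"
  shows "swap u i j \<in> power_exponents p q k"
  by (rule swap_in_power_exponents[OF u _ ij(2,3)]) (use pq ij(1) p in auto)

lemma weight_second_independent_set:
  "p < q \<Longrightarrow> weight (insert p {q<..}) u = lookup u p + weight {q<..} u"
  for p q :: "'n::{finite,linorder}"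
  by (rule weight_insert) simp

text \<open>
  Moving weight to the left keeps all inequalities except possibly that of \<open>{p} \<union> {q<..}\<close> when
  \<open>i = p\<close>. If this one is sharp, then \<open>u\<^sub>p < k\<close> provides a variable after \<open>q\<close> to take the
  weight from.
\<close>

lemma raisable_swap:
  fixes p q :: "'n::{finite,linorder}"
  assumes pq: "p < q" and u: "u \<in> power_exponents p q k" and i: "i \<in> raisable k u"
  shows "\<exists>j>i. 0 < lookup u j \<and> swap u i j \<in> power_exponents p q k"
proof -
  from i obtain j0 where j0: "i < j0" "0 < lookup u j0" and ik: "lookup u i < k"
    by (auto simp: raisable_def)
  have "\<exists>j>i. 0 < lookup u j \<and> (i = p \<longrightarrow> q < j \<or> weight (insert p {q<..}) u < k)"
  proof (cases "i = p \<and> weight (insert p {q<..}) u \<ge> k")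
    case True
    then have "0 < weight {q<..} u" using weight_second_independent_set[OF pq, of u] ik by simp
    then obtain j where "q < j" "0 < lookup u j" by (auto simp: weight_pos_iff)
    then show ?thesis using True pq by (intro exI[of _ j]) auto
  next
    case False
    then show ?thesis using j0 by (intro exI[of _ j0]) auto
  qed
  then obtain j where "i < j" "0 < lookup u j" "i = p \<Longrightarrow> q < j \<or> weight (insert p {q<..}) u < k"
    by blast
  with swap_right_in_power_exponents[OF pq u _ ik] show ?thesis by blast
qed

lemma exchange_variables_power_exponents:
  fixes p q :: "'n::{finite,linorder}"
  assumes pq: "p < q" and u: "u \<in> power_exponents p q k"
  shows "exchange_variables (power_exponents p q k) u = raisable k u"
proof (intro equalityI subsetI)
  fix i assume "i \<in> exchange_variables (power_exponents p q k) u"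
  then obtain j where j: "i < j" "0 < lookup u j" "swap u i j \<in> power_exponents p q k"
    by (auto simp: exchange_variables_def)
  then have "lookup (swap u i j) i \<le> k" by (simp only: power_exponents_def mem_Collect_eq)
  then have "lookup u i < k" using j(1) lookup_swap[of i j u i] by simp
  with j show "i \<in> raisable k u" by (auto simp: raisable_def)
next
  fix i assume "i \<in> raisable k u"
  then show "i \<in> exchange_variables (power_exponents p q k) u"
    using raisable_swap[OF pq u] by (simp add: exchange_variables_def)
qed

lemma weight_eq_of_agree_below:
  fixes v w :: "'n::{finite,linorder} exponent"
  assumes "weight UNIV v = weight UNIV w" "\<And>t. t < i \<Longrightarrow> lookup w t = lookup v t" "{i..} \<subseteq> X"
  shows "weight X v = weight X w"
proof -
  have "weight (- X) v = weight (- X) w"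
    unfolding weight_def
  proof (rule sum.cong)
    fix t assume "t \<in> - X"
    then have "t < i" using assms(3) by (meson ComplD atLeast_iff not_le subsetD)
    then show "lookup v t = lookup w t" using assms(2) by simp
  qed simp
  moreover have "weight UNIV z = weight X z + weight (- X) z" for z :: "'n exponent"
    using weight_Un_disjoint[of X "- X" z] by simp
  ultimately show ?thesis using assms(1) by simp
qed

lemma weight_atLeast: "weight {i..} v = lookup v i + weight {i<..} v"
  for v :: "'n::{finite,linorder} exponent"
proof -
  have "{i..} = insert i {i<..}" by auto
  then show ?thesis by (simp add: weight_insert)
qed

lemma later_variable:
  fixes v w :: "'n::{finite,linorder} exponent"
  assumes "weight UNIV v = weight UNIV w" "\<And>t. t < i \<Longrightarrow> lookup w t = lookup v t"
    "lookup w i < lookup v i"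
  shows "\<exists>j>i. 0 < lookup w j"
proof -
  have "weight {i..} v = weight {i..} w" by (rule weight_eq_of_agree_below[OF assms(1,2)]) auto
  then have "0 < weight {i<..} w" using assms(3) unfolding weight_atLeast by simp
  then show ?thesis by (auto simp: weight_pos_iff)
qed

lemma lex_exchange_power_exponents:
  fixes p q :: "'n::{finite,linorder}"
  assumes pq: "p < q"
  shows "lex_exchange (power_exponents p q k)"
  unfolding lex_exchange_def
proof (intro ballI allI impI)
  fix v w i assume v: "v \<in> power_exponents p q k" and w: "w \<in> power_exponents p q k"
    and i: "lookup w i < lookup v i" "\<forall>l<i. lookup w l = lookup v l"
  have "lookup v i \<le> k" "weight UNIV v = weight UNIV w" using v w by (auto simp: power_exponents_def)
  then have "i \<in> raisable k w"
    using later_variable[of v w i] i by (auto simp: raisable_def)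
  then show "i \<in> exchange_variables (power_exponents p q k) w"
    using exchange_variables_power_exponents[OF pq w] by simp
qed

lemma card_support_le_weight: "card {t \<in> X. 0 < lookup v t} \<le> weight X v" for X :: "'n::finite set"
proof -
  have "card {t \<in> X. 0 < lookup v t} = (\<Sum>t\<in>{t \<in> X. 0 < lookup v t}. 1)" by simp
  also have "\<dots> \<le> (\<Sum>t\<in>{t \<in> X. 0 < lookup v t}. lookup v t)" by (rule sum_mono) auto
  also have "\<dots> \<le> (\<Sum>t\<in>X. lookup v t)" by (rule sum_mono2) auto
  finally show ?thesis by (simp add: weight_def)
qed

lemma raisable_top:
  fixes u :: "'n::{finite,linorder} exponent"
  assumes "t \<in> raisable k u"
  shows "\<exists>m>t. 0 < lookup u m \<and> (\<forall>s>m. lookup u s = 0) \<and> raisable k u \<subseteq> {..<m}"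
proof -
  define m where "m = Max {s. 0 < lookup u s}"
  obtain j where j: "t < j" "0 < lookup u j" using assms by (auto simp: raisable_def)
  have m: "0 < lookup u m" using Max_in[of "{s. 0 < lookup u s}"] j by (auto simp: m_def)
  have top: "s \<le> m" if "0 < lookup u s" for s using that by (auto simp: m_def intro: Max_ge)
  have "\<forall>s>m. lookup u s = 0" using top by (meson leD not_gr0)
  moreover have "t < m" using top[of j] j by simp
  moreover have "raisable k u \<subseteq> {..<m}" using top by (auto simp: raisable_def intro: less_le_trans)
  ultimately show ?thesis using m by auto
qed

text \<open>
  The set \<open>\<sigma>v\<close> misses the largest element of the support of \<open>uv\<close>, which lies in \<open>X\<close>
  because \<open>X\<close> is upward closed and meets \<open>\<sigma>v\<close>; so the support of \<open>v\<close> in \<open>X\<close> has more than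
  \<open>card (\<sigma>v \<inter> X)\<close> elements. After \<open>i\<close> it has at most \<open>card (\<sigma> \<inter> {i<..})\<close> elements,
  and before \<open>i\<close> it agrees with that of \<open>w\<close>. If \<open>\<sigma>\<close> covered it before \<open>i\<close>, it would have at
  most \<open>card (\<sigma> \<inter> X)\<close> elements.
\<close>

lemma spare_support:
  fixes v w uv :: "'n::{finite,linorder} exponent"
  assumes v: "v = uv + indicator_exponent \<sigma>v" "\<sigma>v \<subseteq> raisable k uv"
    and X: "{i..} \<subseteq> X" "\<And>s t. t \<in> X \<Longrightarrow> t < s \<Longrightarrow> s \<in> X"
    and \<sigma>: "i \<in> \<sigma>" "card (\<sigma> \<inter> X) \<le> card (\<sigma>v \<inter> X)"
    and agree: "\<And>t. t < i \<Longrightarrow> lookup w t = lookup v t"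
    and tail: "weight {i<..} v \<le> card (\<sigma> \<inter> {i<..})"
  shows "\<exists>y\<in>X. y < i \<and> 0 < lookup w y \<and> y \<notin> \<sigma>"
proof (rule ccontr)
  assume none: "\<not> ?thesis"
  let ?A = "{t \<in> X. 0 < lookup v t}"
  have "i \<in> \<sigma> \<inter> X" using \<sigma>(1) X(1) by auto
  then have "0 < card (\<sigma> \<inter> X)" by (auto simp: card_gt_0_iff)
  then have "\<sigma>v \<inter> X \<noteq> {}" using \<sigma>(2) by auto
  then obtain t where t: "t \<in> \<sigma>v" "t \<in> X" by blast
  have "t \<in> raisable k uv" using v(2) t(1) by auto
  from raisable_top[OF this] obtain m where m: "0 < lookup uv m" "t < m" "raisable k uv \<subseteq> {..<m}"
    by auto
  have "insert m (\<sigma>v \<inter> X) \<subseteq> ?A"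
    using m(1,2) X(2)[OF t(2), of m] by (auto simp: v(1) lookup_add)
  then have "card (insert m (\<sigma>v \<inter> X)) \<le> card ?A" by (intro card_mono) auto
  moreover have "m \<notin> \<sigma>v" using v(2) m(3) by auto
  ultimately have big: "card (\<sigma>v \<inter> X) < card ?A" by simp
  have "?A \<subseteq> (\<sigma> \<inter> X \<inter> {..i}) \<union> {t \<in> {i<..}. 0 < lookup v t}"
  proof
    fix t assume t: "t \<in> ?A"
    consider "t < i" | "t = i" | "i < t" by fastforce
    then show "t \<in> (\<sigma> \<inter> X \<inter> {..i}) \<union> {t \<in> {i<..}. 0 < lookup v t}"
      using t none agree[of t] \<sigma>(1) by cases auto
  qed
  then have "card ?A \<le> card ((\<sigma> \<inter> X \<inter> {..i}) \<union> {t \<in> {i<..}. 0 < lookup v t})"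
    by (intro card_mono) auto
  also have "\<dots> \<le> card (\<sigma> \<inter> X \<inter> {..i}) + card {t \<in> {i<..}. 0 < lookup v t}"
    by (rule card_Un_le)
  also have "\<dots> \<le> card (\<sigma> \<inter> X \<inter> {..i}) + card (\<sigma> \<inter> {i<..})"
    using card_support_le_weight[of "{i<..}" v] tail by simp
  also have "\<dots> = card ((\<sigma> \<inter> X \<inter> {..i}) \<union> (\<sigma> \<inter> {i<..}))"
    by (rule card_Un_disjoint[symmetric]) auto
  also have "(\<sigma> \<inter> X \<inter> {..i}) \<union> (\<sigma> \<inter> {i<..}) = \<sigma> \<inter> X" using X(1) by fastforce
  finally show False using big \<sigma>(2) by simp
qed

lemma indicator_split:
  fixes w :: "'n::finite exponent"
  assumes "\<And>t. t \<in> \<sigma> \<Longrightarrow> 0 < lookup w t"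
  shows "w = (w - indicator_exponent \<sigma>) + indicator_exponent \<sigma>"
  using assms by (intro poly_mapping_eqI) (auto simp: lookup_add lookup_minus)

text \<open>
  The exchange step when the first difference \<open>i\<close> lies after \<open>q\<close>. The decomposition of
  \<open>x\<^sub>i w / x\<^sub>l\<close> is copied from that of \<open>v\<close>: keep the part of \<open>\<sigma>v\<close> up to \<open>i\<close>, and replace
  the part after \<open>i\<close> by equally many elements of \<open>L\<close>. Since everything from \<open>i\<close> on lies in
  both independent sets, the weights that have to be bounded are the same as those of
  \<open>uv\<close>.
\<close>

lemma shift_exchange_beyond_q:
  fixes p q :: "'n::{finite,linorder}"
  assumes pq: "p < q" and v: "v \<in> shift_exponents p q k r"
    and w: "\<And>t. lookup w t \<le> k" "weight UNIV v = weight UNIV w"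
    and i: "lookup w i < lookup v i" "\<And>t. t < i \<Longrightarrow> lookup w t = lookup v t" "q < i"
    and L: "L \<subseteq> {i<..}" "\<And>t. t \<in> L \<Longrightarrow> t < m \<and> 0 < lookup w t" "l \<in> L" "weight {i<..} v \<le> card L"
    and m: "0 < lookup w m"
  shows "swap w i l \<in> shift_exponents p q k r"
proof -
  obtain uv \<sigma>v where v': "v = uv + indicator_exponent \<sigma>v" "uv \<in> power_exponents p q k"
    "\<sigma>v \<subseteq> raisable k uv" "card \<sigma>v = r" using v by (auto simp: shift_exponents_def)
  have vk: "lookup v t \<le> k" for t
    using v' by (auto simp: v'(1) lookup_add power_exponents_def raisable_def Suc_le_eq)
  have il: "i \<noteq> l" "i < l" "l < m" using L(1-3) by auto
  have wl: "0 < lookup w l" using L(2,3) by blast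
  let ?w = "swap w i l"
  have lw: "lookup ?w t = (if t = i then lookup w i + 1 else if t = l then lookup w l - 1 else lookup w t)" for t
    by (rule lookup_swap[OF il(1)])
  have "card (\<sigma>v \<inter> {i<..}) \<le> card (L - {l})"
  proof (cases "\<sigma>v \<inter> {i<..} = {}")
    case False
    then obtain t where t: "t \<in> \<sigma>v" "i < t" by auto
    have "t \<in> raisable k uv" using v'(3) t(1) by auto
    from raisable_top[OF this] obtain n where n: "0 < lookup uv n" "t < n" "raisable k uv \<subseteq> {..<n}"
      by auto
    have "insert n (\<sigma>v \<inter> {i<..}) \<subseteq> {t \<in> {i<..}. 0 < lookup v t}"
      using n(1,2) t(2) by (auto simp: v'(1) lookup_add)
    then have "card (insert n (\<sigma>v \<inter> {i<..})) \<le> card {t \<in> {i<..}. 0 < lookup v t}"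
      by (intro card_mono) auto
    moreover have "n \<notin> \<sigma>v" using v'(3) n(3) by auto
    ultimately have "card (\<sigma>v \<inter> {i<..}) < card L"
      using card_support_le_weight[of "{i<..}" v] L(4) by simp
    then show ?thesis using L(3) by simp
  qed simp
  then obtain R where R: "R \<subseteq> L - {l}" "card R = card (\<sigma>v \<inter> {i<..})"
    by (meson obtain_subset_with_card_n)
  define \<sigma> where "\<sigma> = (\<sigma>v \<inter> {..i}) \<union> R"
  have Ri: "R \<subseteq> {i<..}" using R L(1) by auto
  have card_X: "card (X \<inter> \<sigma>) = card (X \<inter> \<sigma>v)" if "{i<..} \<subseteq> X" for X
  proof -
    have "X \<inter> \<sigma> = (X \<inter> \<sigma>v \<inter> {..i}) \<union> R" "X \<inter> \<sigma>v = (X \<inter> \<sigma>v \<inter> {..i}) \<union> (\<sigma>v \<inter> {i<..})"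
      using that Ri by (auto simp: \<sigma>_def)
    moreover have "card ((X \<inter> \<sigma>v \<inter> {..i}) \<union> R) = card (X \<inter> \<sigma>v \<inter> {..i}) + card R"
      using Ri by (intro card_Un_disjoint) auto
    moreover have "card ((X \<inter> \<sigma>v \<inter> {..i}) \<union> (\<sigma>v \<inter> {i<..})) = card (X \<inter> \<sigma>v \<inter> {..i}) + card (\<sigma>v \<inter> {i<..})"
      by (intro card_Un_disjoint) auto
    ultimately show ?thesis using R(2) by simp
  qed
  have pos: "0 < lookup ?w t" if "t \<in> \<sigma>" for t
  proof (cases "t \<in> R")
    case True
    then show ?thesis using R(1) L(2)[of t] lw[of t] by auto
  next
    case False
    then have t: "t \<in> \<sigma>v" "t \<le> i" using that by (auto simp: \<sigma>_def)
    then have "0 < lookup v t" by (simp add: v'(1) lookup_add)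
    then show ?thesis using t(2) i(2)[of t] il(2) by (cases "t = i") (auto simp: lw)
  qed
  define u where "u = ?w - indicator_exponent \<sigma>"
  have wu: "?w = u + indicator_exponent \<sigma>" unfolding u_def by (rule indicator_split[OF pos])
  have weight_u: "weight X u = weight X uv" if "{i..} \<subseteq> X" for X
  proof -
    have "i \<in> X" "l \<in> X" using that il(2) by auto
    then have "weight X ?w = weight X w" using weight_swap[OF il(1) wl, of X] by simp
    also have "\<dots> = weight X v" using weight_eq_of_agree_below[OF w(2) i(2) that] by simp
    finally have "weight X ?w = weight X v" .
    then have "weight X u + card (X \<inter> \<sigma>) = weight X uv + card (X \<inter> \<sigma>v)"
      by (simp only: wu v'(1) weight_add weight_indicator)
    moreover have "{i<..} \<subseteq> X" using that by auto
    ultimately show ?thesis using card_X by simp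
  qed
  have wk: "lookup ?w t \<le> k" for t
    using w(1)[of t] i(1) vk[of i] by (auto simp: lw intro: le_trans[OF diff_le_self])
  have "lookup u t \<le> k" for t
    unfolding u_def lookup_minus[of ?w] by (rule le_trans[OF diff_le_self wk])
  moreover have "{i..} \<subseteq> {p<..}" "{i..} \<subseteq> insert p {q<..}" using i(3) pq by auto
  ultimately have uM: "u \<in> power_exponents p q k"
    using weight_u[of UNIV] weight_u[of "{p<..}"] weight_u[of "insert p {q<..}"] v'(2)
    by (auto simp: power_exponents_def)
  have "\<sigma> \<subseteq> raisable k u"
  proof
    fix t assume t: "t \<in> \<sigma>"
    have "lookup ?w t = lookup u t + 1" using t by (subst wu) (simp add: lookup_add)
    then have "lookup u t < k" using wk[of t] by simp
    moreover have "t < m" using t R(1) L(2) il by (fastforce simp: \<sigma>_def)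
    moreover have "m \<notin> \<sigma>" using R(1) L(2) il by (fastforce simp: \<sigma>_def)
    then have "0 < lookup u m" using m il lw[of m] by (simp add: u_def lookup_minus)
    ultimately show "t \<in> raisable k u" by (auto simp: raisable_def)
  qed
  moreover have "card \<sigma> = r" using card_X[of UNIV] v'(4) by simp
  ultimately show ?thesis unfolding shift_exponents_def using uM wu by blast
qed

text \<open>
  Write \<open>w = u x\<^sub>\<sigma>\<close>, and let \<open>m\<close> be the largest element of the support of \<open>u\<close>. If \<open>i \<notin> \<sigma>\<close>,
  either an element of \<open>\<sigma>\<close> after \<open>i\<close> is replaced by \<open>i\<close>, or the exchange is performed in
  \<open>u\<close>. If \<open>i \<in> \<sigma>\<close>, it is performed in \<open>u\<close> unless this removes \<open>m\<close> from the support,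
  which has to reach beyond \<open>\<sigma>\<close>. This leaves the case that \<open>x\<^sub>m\<close>, to the first
  power, is the only variable of \<open>u\<close> after \<open>i\<close>. Let \<open>L\<close> be the part of \<open>\<sigma>\<close> after \<open>i\<close>. If \<open>L\<close> is empty, degrees force
  \<open>v = x\<^sub>i w / x\<^sub>m\<close>. Otherwise some \<open>x\<^sub>l\<close> with \<open>l \<in> L\<close> is given up. For \<open>i \<le> q\<close> its place in
  \<open>\<sigma>\<close> is taken by a variable \<open>x\<^sub>y\<close> of \<open>u\<close> with \<open>y < i\<close>, which exists by the count of
  supports in \<open>spare_support\<close>, and \<open>u\<close> becomes \<open>x\<^sub>i u / x\<^sub>y\<close>.
  For \<open>i > q\<close> see \<open>shift_exchange_beyond_q\<close>.
\<close>

theorem lex_exchange_shift_exponents: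
  fixes p q :: "'n::{finite,linorder}"
  assumes pq: "p < q"
  shows "lex_exchange (shift_exponents p q k r)"
  unfolding lex_exchange_def
proof (intro ballI allI impI)
  let ?M = "power_exponents p q k" and ?G = "shift_exponents p q k r" and ?B = "insert p {q<..}"
  fix v w i assume v: "v \<in> ?G" and w: "w \<in> ?G"
    and i: "lookup w i < lookup v i" "\<forall>l<i. lookup w l = lookup v l"
  obtain u \<sigma> where w': "w = u + indicator_exponent \<sigma>" "u \<in> ?M" "\<sigma> \<subseteq> raisable k u" "card \<sigma> = r"
    using w by (auto simp: shift_exponents_def)
  obtain uv \<sigma>v where v': "v = uv + indicator_exponent \<sigma>v" "uv \<in> ?M" "\<sigma>v \<subseteq> raisable k uv" "card \<sigma>v = r"
    using v by (auto simp: shift_exponents_def)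
  have lw: "lookup w t = lookup u t + (if t \<in> \<sigma> then 1 else 0)" for t
    by (simp add: w'(1) lookup_add)
  have uk: "lookup u t \<le> k" for t using w'(2) by (simp add: power_exponents_def)
  have vk: "lookup v t \<le> k" for t
    using v' by (auto simp: v'(1) lookup_add power_exponents_def raisable_def Suc_le_eq)
  have wk: "lookup w t \<le> k" for t
    using w' by (auto simp: w'(1) lookup_add power_exponents_def raisable_def Suc_le_eq)
  have deg: "weight UNIV v = weight UNIV w"
    using w'(2,4) v'(2,4) by (simp add: w'(1) v'(1) weight_add weight_indicator power_exponents_def)
  have agree: "lookup w t = lookup v t" if "t < i" for t using i(2) that by blast
  have GI: "swap w i j \<in> ?G" if "u' \<in> ?M" "\<sigma>' \<subseteq> raisable k u'" "card \<sigma>' = r"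
    "swap w i j = u' + indicator_exponent \<sigma>'" for j u' \<sigma>'
    unfolding shift_exponents_def using that by blast
  have "i \<in> raisable k u"
  proof -
    obtain j where j: "i < j" "0 < lookup w j" using later_variable[OF deg agree i(1)] by blast
    have "\<exists>j>i. 0 < lookup u j"
    proof (cases "j \<in> \<sigma>")
      case True
      then obtain j' where "j < j'" "0 < lookup u j'" using w'(3) by (auto simp: raisable_def)
      then show ?thesis using j(1) by (meson less_trans)
    next
      case False
      then show ?thesis using j lw[of j] by auto
    qed
    moreover have "lookup u i < k" using i(1) vk[of i] lw[of i] by simp
    ultimately show ?thesis by (simp add: raisable_def)
  qed
  from raisable_top[OF this] obtain m
    where m: "0 < lookup u m" "\<And>s. m < s \<Longrightarrow> lookup u s = 0" "i < m" "raisable k u \<subseteq> {..<m}"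
    by auto
  have \<sigma>m: "t < m" if "t \<in> \<sigma>" for t using that w'(3) m(4) by auto
  have wm: "0 < lookup w m" using m(1) lw[of m] by simp
  have uik: "lookup u i < k" using \<open>i \<in> raisable k u\<close> by (simp add: raisable_def)
  have \<sigma>k: "lookup u t < k" if "t \<in> \<sigma>" for t using that w'(3) by (auto simp: raisable_def)
  have "\<exists>j>i. 0 < lookup w j \<and> swap w i j \<in> ?G"
  proof (cases "i \<in> \<sigma>")
    case False
    show ?thesis
    proof (cases "\<exists>l\<in>\<sigma>. i < l")
      case True
      then obtain l where l: "l \<in> \<sigma>" "i < l" by blast
      have "swap w i l = u + indicator_exponent (insert i (\<sigma> - {l}))"
        using l False by (intro poly_mapping_eqI) (auto simp: lookup_swap lw lookup_add)
      moreover have "card (insert i (\<sigma> - {l})) = r"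
        using False l(1) w'(4) by (simp add: card_Diff_singleton card_gt_0_iff)
          (metis Suc_pred card_gt_0_iff empty_iff finite)
      moreover have "insert i (\<sigma> - {l}) \<subseteq> raisable k u" using w'(3) \<open>i \<in> raisable k u\<close> by auto
      ultimately have "swap w i l \<in> ?G" using GI w'(2) by blast
      moreover have "0 < lookup w l" using l lw[of l] by simp
      ultimately show ?thesis using l(2) by blast
    next
      case none: False
      obtain j where j: "i < j" "0 < lookup u j" "swap u i j \<in> ?M"
        using raisable_swap[OF pq w'(2) \<open>i \<in> raisable k u\<close>] by blast
      have ij: "i \<noteq> j" using j(1) by simp
      have lo: "t < i" if "t \<in> \<sigma>" for t using that none False by (metis linorder_neqE)
      have "swap w i j = swap u i j + indicator_exponent \<sigma>"
        using j by (intro poly_mapping_eqI) (auto simp: lookup_swap[OF ij] lw lookup_add[of "swap u i j"])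
      moreover have "\<sigma> \<subseteq> raisable k (swap u i j)"
      proof
        fix t assume t: "t \<in> \<sigma>"
        have "lookup (swap u i j) t < k" using \<sigma>k[OF t] lo[OF t] j(1) by (auto simp: lookup_swap[OF ij])
        moreover have "0 < lookup (swap u i j) i" by (simp add: lookup_swap[OF ij])
        ultimately show "t \<in> raisable k (swap u i j)"
          using lo[OF t] unfolding raisable_def by blast
      qed
      ultimately have "swap w i j \<in> ?G" using GI[OF j(3) _ w'(4)] by blast
      moreover have "0 < lookup w j" using j(2) lw[of j] by simp
      ultimately show ?thesis using j(1) by blast
    qed
  next
    case i\<sigma>: True
    then have uik2: "lookup u i + 2 \<le> k" using i(1) vk[of i] lw[of i] by simp
    show ?thesis
    proof (cases "\<exists>j>i. 0 < lookup u j \<and> (j \<noteq> m \<or> 2 \<le> lookup u m) \<and> swap u i j \<in> ?M")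
      case True
      then obtain j where j: "i < j" "0 < lookup u j" "j \<noteq> m \<or> 2 \<le> lookup u m" "swap u i j \<in> ?M" by blast
      have ij: "i \<noteq> j" using j(1) by simp
      have "swap w i j = swap u i j + indicator_exponent \<sigma>"
        using j by (intro poly_mapping_eqI) (auto simp: lookup_swap[OF ij] lw lookup_add[of "swap u i j"])
      moreover have "\<sigma> \<subseteq> raisable k (swap u i j)"
      proof
        fix t assume t: "t \<in> \<sigma>"
        have "lookup (swap u i j) t < k" using \<sigma>k[OF t] uik2 by (auto simp: lookup_swap[OF ij])
        moreover have "0 < lookup (swap u i j) m" using j(3) m(1,3) by (auto simp: lookup_swap[OF ij])
        ultimately show "t \<in> raisable k (swap u i j)"
          using \<sigma>m[OF t] unfolding raisable_def by blast
      qed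
      ultimately have "swap w i j \<in> ?G" using GI[OF j(4) _ w'(4)] by blast
      moreover have "0 < lookup w j" using j(2) lw[of j] by simp
      ultimately show ?thesis using j(1) by blast
    next
      case stuck: False
      \<comment> \<open>If the second weight were sharp, all of the at least two units of weight after \<open>q\<close> could be
        moved to \<open>p\<close>, and one of these moves leaves \<open>m\<close> in the support.\<close>
      have Bp: "weight ?B u < k" if "i = p"
      proof (rule ccontr)
        assume full: "\<not> weight ?B u < k"
        then have C: "2 \<le> weight {q<..} u"
          using uik2 weight_second_independent_set[OF pq, of u] that by simp
        have sw: "swap u i j \<in> ?M" if "q < j" "0 < lookup u j" for j
          using that pq \<open>i = p\<close> uik by (intro swap_right_in_power_exponents[OF pq w'(2)]) auto
        obtain j where j: "q < j" "0 < lookup u j" using C weight_pos_iff[of "{q<..}" u] by auto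
        have "j \<le> m" using m(2)[of j] j(2) by (cases "m < j") auto
        then have qm: "q < m" using j(1) by simp
        have "lookup u m = 1" using stuck sw[OF qm m(1)] m(1,3) by force
        moreover have "weight {q<..} u = lookup u m + weight ({q<..} - {m}) u"
          using weight_insert[of m "{q<..} - {m}" u] qm by (simp add: insert_absorb)
        ultimately have "0 < weight ({q<..} - {m}) u" using C by simp
        then obtain j' where "q < j'" "j' \<noteq> m" "0 < lookup u j'" by (auto simp: weight_pos_iff)
        then show False using stuck sw[of j'] that pq by (meson less_trans)
      qed
      have sw: "swap u i j \<in> ?M" if "i < j" "0 < lookup u j" for j
        using Bp by (intro swap_right_in_power_exponents[OF pq w'(2) that(1) uik that(2)]) auto
      have um: "lookup u m = 1" using stuck sw[OF m(3,1)] m(1,3) by force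
      have u0: "lookup u t = 0" if "i < t" "t \<noteq> m" for t
        using stuck sw[of t] that by auto
      define L where "L = \<sigma> \<inter> {i<..}"
      have wt: "lookup w t = (if t \<in> insert m L then 1 else 0)" if "i < t" for t
        using lw[of t] u0[OF that] um \<sigma>m[of m] that by (auto simp: L_def)
      have mL: "m \<notin> L" using \<sigma>m by (auto simp: L_def)
      have "weight {i<..} w = (\<Sum>t\<in>{i<..}. if t \<in> insert m L then 1 else 0)"
        unfolding weight_def using wt by (intro sum.cong) auto
      also have "\<dots> = card ({i<..} \<inter> insert m L)" by (simp only: sum.If_cases finite Collect_mem_eq) simp
      also have "{i<..} \<inter> insert m L = insert m L" using m(3) by (auto simp: L_def)
      finally have ww: "weight {i<..} w = Suc (card L)" using mL by simp
      have tails: "lookup v i + weight {i<..} v = lookup w i + weight {i<..} w"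
        using weight_eq_of_agree_below[OF deg agree, where X = "{i..}"] unfolding weight_atLeast by simp
      then have wv: "weight {i<..} v \<le> card L" using i(1) ww by simp
      show ?thesis
      proof (cases "L = {}")
        case True
        then have v0: "lookup v t = 0" if "i < t" for t
          using wv lookup_le_weight[of t "{i<..}" v] that by simp
        have vi: "lookup v i = lookup w i + 1" using tails wv ww True by simp
        have im: "i \<noteq> m" using m(3) by simp
        have "swap w i m = v"
        proof (rule poly_mapping_eqI)
          fix t
          consider "t < i" | "t = i" | "i < t" by fastforce
          then show "lookup (swap w i m) t = lookup v t"
            using agree[of t] vi v0[of t] wt[of t] True m(3) by cases (auto simp: lookup_swap[OF im])
        qed
        then show ?thesis using v wm m(3) by blast
      next
        case False
        then obtain l where l: "l \<in> L" by blast
        then have l': "l \<in> \<sigma>" "i < l" "l < m" using \<sigma>m by (auto simp: L_def)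
        have il: "i \<noteq> l" using l'(2) by simp
        have wl: "0 < lookup w l" using lw[of l] l'(1) by simp
        have "swap w i l \<in> ?G"
        proof (cases "q < i")
          case True
          show ?thesis
          proof (rule shift_exchange_beyond_q[OF pq v wk deg i(1) agree True _ _ l wv wm])
            show "L \<subseteq> {i<..}" by (simp add: L_def)
            show "t < m \<and> 0 < lookup w t" if "t \<in> L" for t
              using that \<sigma>m lw[of t] by (auto simp: L_def)
          qed
        next
          case iq: False
          have "\<exists>y. y < i \<and> 0 < lookup w y \<and> y \<notin> \<sigma> \<and> (p < i \<longrightarrow> p < y \<or> weight {p<..} u < k)"
          \<comment> \<open>Moving weight from \<open>y\<close> to \<open>i\<close> may raise the weight of \<open>{p<..}\<close>; if this is sharp,
            \<open>y\<close> has to be found inside \<open>{p<..}\<close>.\<close>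
          proof (cases "p < i \<and> \<not> weight {p<..} u < k")
            case True
            then have full: "weight {p<..} u = k" using w'(2) by (simp add: power_exponents_def)
            have "weight {p<..} v = weight {p<..} w"
              by (rule weight_eq_of_agree_below[OF deg agree]) (use True in auto)
            then have "weight {p<..} uv + card ({p<..} \<inter> \<sigma>v) = k + card ({p<..} \<inter> \<sigma>)"
              by (simp add: w'(1) v'(1) weight_add weight_indicator full)
            moreover have "weight {p<..} uv \<le> k" using v'(2) by (simp add: power_exponents_def)
            ultimately have card_le: "card (\<sigma> \<inter> {p<..}) \<le> card (\<sigma>v \<inter> {p<..})"
              by (simp add: Int_commute)
            have "\<exists>y\<in>{p<..}. y < i \<and> 0 < lookup w y \<and> y \<notin> \<sigma>"
              by (rule spare_support[OF v'(1,3) _ _ i\<sigma> card_le agree])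
                (use True wv in \<open>auto simp: L_def\<close>)
            then show ?thesis by auto
          next
            case False
            have "\<exists>y\<in>UNIV. y < i \<and> 0 < lookup w y \<and> y \<notin> \<sigma>"
              by (rule spare_support[OF v'(1,3) _ _ i\<sigma> _ agree])
                (use wv w'(4) v'(4) in \<open>auto simp: L_def\<close>)
            then show ?thesis using False by blast
          qed
          then obtain y where y: "y < i" "0 < lookup w y" "y \<notin> \<sigma>" "p < i \<Longrightarrow> p < y \<or> weight {p<..} u < k"
            by blast
          have iy: "i \<noteq> y" and uy: "0 < lookup u y" using y(1-3) lw[of y] by auto
          have sy: "swap u i y \<in> ?M"
            by (rule swap_in_power_exponents[OF w'(2) iy uik uy y(4)]) (use Bp iq in auto)
          let ?\<sigma> = "insert y (\<sigma> - {l})"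
          have "swap w i l = swap u i y + indicator_exponent ?\<sigma>"
          proof (rule poly_mapping_eqI)
            fix t
            show "lookup (swap w i l) t = lookup (swap u i y + indicator_exponent ?\<sigma>) t"
              using y(1,3) uy i\<sigma> l' u0[of l]
              by (simp only: lookup_add[of "swap u i y"] lookup_swap[OF il] lookup_swap[OF iy]
                  lookup_indicator_exponent lw) auto
          qed
          moreover have "?\<sigma> \<subseteq> raisable k (swap u i y)"
          proof
            fix t assume t: "t \<in> ?\<sigma>"
            have "lookup (swap u i y) t < k"
              using t \<sigma>k[of t] uik2 uk[of y] uy by (auto simp: lookup_swap[OF iy])
            moreover have "0 < lookup (swap u i y) m" using y(1) m(1,3) by (auto simp: lookup_swap[OF iy])
            moreover have "t < m" using t \<sigma>m[of t] y(1) m(3) by auto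
            ultimately show "t \<in> raisable k (swap u i y)" unfolding raisable_def by blast
          qed
          moreover have "card ?\<sigma> = r"
            using y(3) l'(1) w'(4) by (simp add: card_Diff_singleton card_gt_0_iff)
              (metis Suc_pred card_gt_0_iff empty_iff finite)
          ultimately show ?thesis using GI[OF sy] by blast
        qed
        then show ?thesis using l'(2) wl by blast
      qed
    qed
  qed
  then show "i \<in> exchange_variables ?G w" by (simp add: exchange_variables_def)
qed

section \<open>Powers of initial lexsegment edge ideals\<close>

lemma ideal_power_lexsegment:
  fixes p q :: "'n::{finite,linorder}"
  assumes pq: "p < q"
  shows "ideal_power (initial_lexsegment_ideal (unit_exponent p + unit_exponent q)) k
    = (monomial_ideal (power_exponents p q k) :: ('n, 'k::field) mpoly set)"
proof (induction k)
  case 0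
  have "c \<in> keys f \<Longrightarrow> \<exists>b. c = 0 + b" for c and f :: "('n, 'k) mpoly" by simp
  then show ?case by (auto simp: power_exponents_0 monomial_ideal_def)
next
  case (Suc k)
  have "total_degree (unit_exponent p + unit_exponent q) = 2"
    by (simp only: total_degree_add) (simp flip: weight_UNIV add: weight_unit[simplified])
  then have "initial_lexsegment_ideal (unit_exponent p + unit_exponent q)
      = (monomial_ideal (power_exponents p q 1) :: ('n, 'k) mpoly set)"
    unfolding edge_exponents[OF pq, symmetric] ideal_generated_monomials[symmetric]
      initial_lexsegment_ideal_def
    by (auto intro!: arg_cong[of _ _ ideal_generated])
  with Suc show ?case
    by (simp only: ideal_power.simps ideal_product_monomial_ideals power_exponents_Suc[OF pq])
qed

lemma homological_shift_ideal_power: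
  fixes p q :: "'n::{finite,linorder}"
  assumes pq: "p < q"
  shows "homological_shift_ideal r (monomial_ideal (power_exponents p q k) :: ('n, 'k::field) mpoly set)
    = monomial_ideal (shift_exponents p q k r)"
proof -
  have "Tor_nonzero r (monomial_ideal (power_exponents p q k) :: ('n, 'k) mpoly set) a
      \<longleftrightarrow> a \<in> shift_exponents p q k r" for a
  proof -
    have "Tor_nonzero r (monomial_ideal (power_exponents p q k) :: ('n, 'k) mpoly set) a \<longleftrightarrow>
      (\<exists>w\<in>power_exponents p q k. \<exists>\<tau>\<subseteq>exchange_variables (power_exponents p q k) w.
        card \<tau> = r \<and> a = w + indicator_exponent \<tau>)"
      by (rule lex_exchange_Tor[OF finite_power_exponents lex_exchange_power_exponents[OF pq]])
        (auto simp: power_exponents_def weight_UNIV)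
    then show ?thesis
      using exchange_variables_power_exponents[OF pq] by (auto simp: shift_exponents_def)
  qed
  then have "{monomial a | a. Tor_nonzero r (monomial_ideal (power_exponents p q k) :: ('n, 'k) mpoly set) a}
      = (monomial ` shift_exponents p q k r :: ('n, 'k) mpoly set)" by auto
  then show ?thesis
    by (simp add: homological_shift_ideal_def ideal_generated_monomials)
qed

lemma finite_shift_exponents: "finite (shift_exponents p q k r)"
proof (rule finite_subset)
  show "shift_exponents p q k r
      \<subseteq> (\<lambda>(u, \<sigma>). u + indicator_exponent \<sigma>) ` (power_exponents p q k \<times> UNIV)"
    by (auto simp: shift_exponents_def)
qed (simp add: finite_power_exponents)

lemma powers_have_homological_linear_resolution:
  fixes p q :: "'n::{finite,linorder}"
  assumes pq: "p < q"
  shows "has_homological_linear_powers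
    (initial_lexsegment_ideal (unit_exponent p + unit_exponent q) :: ('n, 'k::field) mpoly set)"
  unfolding has_homological_linear_powers_def ideal_power_lexsegment[OF pq]
    homological_shift_ideal_power[OF pq]
proof (intro allI impI lex_exchange_linear_resolution[OF finite_shift_exponents
      lex_exchange_shift_exponents[OF pq]])
  show "total_degree w = 2 * k + r" if "w \<in> shift_exponents p q k r" for w k r
    using that by (auto simp: shift_exponents_def total_degree_add power_exponents_def weight_UNIV)
qed

text \<open>
  Squarefreeness means \<open>p \<noteq> q\<close>, and \<open>x\<^sub>p x\<^sub>q\<close> is symmetric in \<open>p\<close> and \<open>q\<close>.
\<close>

theorem theorem4p5:
  fixes p q :: "'n::{finite,linorder}"
    and v :: "'n exponent"
    and I :: "('n, 'k::field) mpoly set"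
  assumes "v = Poly_Mapping.single p 1 + Poly_Mapping.single q 1"
    and "squarefree_exponent v"
    and "I = initial_lexsegment_ideal v"
  shows "has_homological_linear_powers I"
proof -
  have "p \<noteq> q"
  proof
    assume "p = q"
    then have "lookup v p = 2" by (simp add: assms(1) lookup_add)
    moreover have "lookup v p \<le> 1" using assms(2) by (simp only: squarefree_exponent_def)
    ultimately show False by simp
  qed
  then consider "p < q" | "q < p" by fastforce
  then show ?thesis
    unfolding assms(1,3) One_nat_def
    by cases (use powers_have_homological_linear_resolution[of q p] in
      \<open>simp_all add: powers_have_homological_linear_resolution add.commute\<close>)
qed

end
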